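(* Let $J,R,Q\in\mathbb{R}^{n\times n}$ with $J$ skew-symmetric, $R$ symmetric positive semidefinite, $Q$ symmetric positive definite, let $B\in\mathbb{R}^{n\times m}$ have full rank $m\le n$, and set $A=(J-R)Q$. Let $\mathbb{U}=[\underline{u}_1,\overline{u}_1]\times\dots\times[\underline{u}_m,\overline{u}_m]\subset\mathbb{R}^m$ be compact with $0\in\operatorname{int}(\mathbb{U})$. Assume that $\operatorname{rank}(B,AB,\ldots,A^{n-1}B)=n$. Let $\mathbb{R}^n=M_1\oplus_Q M_2$ be the decomposition into the conservative subspace $M_1$ and the dissipative subspace $M_2$, and let $J_1,J_2,R_2,B_1,B_2$ be the corresponding blocks (see context). Let $x_1^0\in M_1$ and $x_2^0\in M_2$. Then: (i) For every state $x_1^\star\in M_1$ there exist a time $T>0$ and a control $u\in L^1(0,T;\mathbb{U})$ which steers $x_1^0$ to $x_1^\star$ at time $T$ under the dynamics $\dot x_1=J_1x_1+B_1u$, $x_1(0)=x_1^0$. (ii) The set of states in $M_2$ that can be reached from $x_2^0$ in arbitrary time with controls $u\in L^1(0,T;\mathbb{U})$, $T\ge 0$, under the dynamics $\dot x_2=(J_2-R_2)x_2+B_2u$, $x_2(0)=x_2^0$, is bounded in $M_2$.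
   Context: $L^1(0,T;\mathbb{U})$ is the set of Lebesgue-measurable, integrable functions on $(0,T)$ with values in $\mathbb{U}$; differential equations hold almost everywhere with absolutely continuous solutions. Decomposition: for $\lambda\in\mathbb{C}$ let $N_\lambda(A)=\operatorname{span}\{\operatorname{Re}(x),\operatorname{Im}(x):x\in\ker(A-\lambda I_n)\}\subset\mathbb{R}^n$ (kernel in $\mathbb{C}^n$). Set $M_1=\operatorname{span}\{N_{i\alpha}(A): \alpha\in\mathbb{R},\ i\alpha\in\sigma(A)\}$ and let $M_2$ be the orthogonal complement of $M_1$ with respect to the inner product $\langle Q\,\cdot,\cdot\rangle$. Both subspaces are invariant under $JQ$ and $RQ$, and $RQ$ vanishes on $M_1$. One sets $J_j=JQ|_{M_j}$ ($j=1,2$), $R_2=RQ|_{M_2}$; $J_1,J_2$ are skew-symmetric and $R_2$ is positive semidefinite with respect to $\langle Q\,\cdot,\cdot\rangle$, and $J_2-R_2$ is Hurwitz. $B_j:\mathbb{R}^m\to M_j$ is $B$ followed by the projection onto $M_j$ along the other subspace. Thus the system $\dot x=(J-R)Qx+Bu$ splits into the two systems in (i) and (ii). *)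

theory Defs
  imports "HOL-Analysis.Analysis"
begin

definition complex_kernel :: "real^'n^'n \<Rightarrow> complex \<Rightarrow> (complex^'n) set" where
  "complex_kernel A \<mu> = {x. (map_matrix complex_of_real A - mat \<mu>) *v x = 0}"

definition complex_spectrum :: "real^'n^'n \<Rightarrow> complex set" where
  "complex_spectrum A = {\<mu>. \<exists>x\<in>complex_kernel A \<mu>. x \<noteq> 0}"

definition Re_vec :: "complex^'n \<Rightarrow> real^'n" where
  "Re_vec x = (\<chi> i. Re (x $ i))"

definition Im_vec :: "complex^'n \<Rightarrow> real^'n" where
  "Im_vec x = (\<chi> i. Im (x $ i))"

definition real_eigenspace :: "real^'n^'n \<Rightarrow> complex \<Rightarrow> (real^'n) set" where
  "real_eigenspace A \<mu> = span (Re_vec ` complex_kernel A \<mu> \<union> Im_vec ` complex_kernel A \<mu>)"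

definition conservative_subspace :: "real^'n^'n \<Rightarrow> (real^'n) set" where
  "conservative_subspace A =
     span (\<Union>\<alpha>\<in>{\<alpha>. \<i> * complex_of_real \<alpha> \<in> complex_spectrum A}.
             real_eigenspace A (\<i> * complex_of_real \<alpha>))"

definition dissipative_subspace :: "real^'n^'n \<Rightarrow> real^'n^'n \<Rightarrow> (real^'n) set" where
  "dissipative_subspace Q A = {x. \<forall>y\<in>conservative_subspace A. (Q *v x) \<bullet> y = 0}"

(* Only meaningful if the ambient space is the direct sum of M and N. *)
definition proj_along :: "'a::real_vector set \<Rightarrow> 'a set \<Rightarrow> 'a \<Rightarrow> 'a" where
  "proj_along M N x = (THE y. y \<in> M \<and> x - y \<in> N)"

(* The n x nm block matrix (B, AB, ..., A^(n-1) B).  Column (k, j) is column j of block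
   number to_nat_on UNIV k; since to_nat_on UNIV is a bijection from 'n onto {..<CARD('n)},
   every block occurs exactly once.  The choice of enumeration only permutes the blocks. *)
definition controllability_matrix :: "real^'n^'n \<Rightarrow> real^'m^'n \<Rightarrow> real^('n \<times> 'm)^'n" where
  "controllability_matrix A B =
     (\<chi> i kj. (((\<lambda>X. A ** X) ^^ to_nat_on (UNIV :: 'n set) (fst kj)) B) $ i $ snd kj)"

(* Each pair (s, t) in D stands for the interval from s to t. *)
definition abs_continuous_on :: "real \<Rightarrow> real \<Rightarrow> (real \<Rightarrow> 'a::metric_space) \<Rightarrow> bool" where
  "abs_continuous_on a b f \<longleftrightarrow>
     (\<forall>\<epsilon>>0. \<exists>\<delta>>0. \<forall>D :: (real \<times> real) set.
        finite D \<and> (\<forall>(s, t)\<in>D. a \<le> s \<and> s \<le> t \<and> t \<le> b) \<and>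
        pairwise (\<lambda>I I'. disjnt {fst I<..<snd I} {fst I'<..<snd I'}) D \<and>
        (\<Sum>(s, t)\<in>D. t - s) < \<delta>
        \<longrightarrow> (\<Sum>(s, t)\<in>D. dist (f s) (f t)) < \<epsilon>)"

definition L1_controls :: "real \<Rightarrow> 'b::euclidean_space set \<Rightarrow> (real \<Rightarrow> 'b) set" where
  "L1_controls T U = {u. set_integrable lebesgue {0<..<T} u \<and> (\<forall>t\<in>{0<..<T}. u t \<in> U)}"

(* x' = F x + G u on the state space M. *)
definition steers ::
  "'a::euclidean_space set \<Rightarrow> ('a \<Rightarrow> 'a) \<Rightarrow> ('b \<Rightarrow> 'a) \<Rightarrow> (real \<Rightarrow> 'b) \<Rightarrow> real \<Rightarrow> 'a \<Rightarrow> 'a \<Rightarrow> bool" where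
  "steers M F G u T x0 x1 \<longleftrightarrow>
     (\<exists>x. abs_continuous_on 0 T x \<and> (\<forall>t\<in>{0..T}. x t \<in> M) \<and> x 0 = x0 \<and> x T = x1 \<and>
          (AE t in lebesgue. t \<in> {0<..<T} \<longrightarrow>
             (x has_vector_derivative (F (x t) + G (u t))) (at t)))"

definition reachable_set ::
  "'a::euclidean_space set \<Rightarrow> ('a \<Rightarrow> 'a) \<Rightarrow> ('b::euclidean_space \<Rightarrow> 'a) \<Rightarrow> 'b set \<Rightarrow> 'a \<Rightarrow> 'a set" where
  "reachable_set M F G U x0 = {x1. \<exists>T\<ge>0. \<exists>u\<in>L1_controls T U. steers M F G u T x0 x1}"

end

theory Submission
  imports Defs
begin

text \<open>
  With respect to \<open>\<langle>x, y\<rangle> = Q x \<bullet> y\<close>, the operator \<open>K = J Q\<close> is skew and \<open>S = R Q\<close> is symmetric positive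
  semidefinite, and \<open>S\<close> vanishes on \<open>M\<^sub>1\<close>.

  (i) On \<open>M\<^sub>1\<close> the flow of \<open>K\<close> is isometric, so the Gramian over a time interval of length \<open>N\<close> is bounded
  below by \<open>c N\<close>; the Kalman condition gives \<open>c > 0\<close>.  The Gramian control that performs the
  prescribed transfer therefore has size \<open>O(1/N)\<close> and lies in \<open>U\<close> for large \<open>N\<close>.

  (ii) A subspace of \<open>M\<^sub>2\<close> that is invariant under \<open>K\<close> and on which \<open>S\<close> vanishes would contain an
  eigenplane of \<open>K\<close>, hence a part of \<open>M\<^sub>1\<close>; so it is trivial.  This yields a quadratic form on \<open>M\<^sub>2\<close>
  that decreases strictly along \<open>K - S\<close>, and with bounded inputs it decreases along trajectories
  outside a fixed ball.
\<close>

subsection \<open>Absolutely continuous functions\<close>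

text \<open>The two parts make different demands. Part (i) only has to exhibit one control, and a
  continuous one will do. Part (ii) concerns every measurable control, so the equation holds only
  almost everywhere and the decrease of a Lyapunov function has to come from absolute continuity.
  The obstacle in (ii) is that \<open>ip\<close> itself decreases only weakly:
  \<open>ip x (gen x) = - ip x (S x)\<close>, and \<open>S\<close> may have a kernel inside
  \<open>diss\<close>. The strict form is built from the resolvent of \<open>gen\<close> by linear
  algebra, without its exponential or its spectrum. In (i) the displacement to be produced,
  \<open>flow (- T) x1 - x0\<close>, moves with the horizon; isometry of the flow also keeps it
  bounded as T grows, and this is what turns a Gramian of order T into controls of order
  1/T.\<close>

definition short_family :: "real \<Rightarrow> real \<Rightarrow> real \<Rightarrow> (real \<times> real) set \<Rightarrow> bool" where
  "short_family a b \<delta> D \<longleftrightarrow>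
     finite D \<and> (\<forall>(s, t)\<in>D. a \<le> s \<and> s \<le> t \<and> t \<le> b) \<and>
     pairwise (\<lambda>I I'. disjnt {fst I<..<snd I} {fst I'<..<snd I'}) D \<and>
     (\<Sum>(s, t)\<in>D. t - s) < \<delta>"

lemma abs_continuous_on_iff:
  "abs_continuous_on a b f \<longleftrightarrow>
     (\<forall>\<epsilon>>0. \<exists>\<delta>>0. \<forall>D. short_family a b \<delta> D \<longrightarrow> (\<Sum>(s, t)\<in>D. dist (f s) (f t)) < \<epsilon>)"
  unfolding abs_continuous_on_def short_family_def ..

text \<open>A gauge argument: tags outside a null set \<open>N\<close> use the sign of the
  derivative, tags in \<open>N\<close> lie in intervals inside an open set of measure below
  \<delta>, where absolute continuity bounds the total variation of \<open>g\<close>.\<close>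

lemma abs_continuous_on_nonincreasing:
  fixes g :: "real \<Rightarrow> real"
  assumes ab: "a \<le> b" and ac: "abs_continuous_on a b g"
    and deriv: "AE t in lebesgue. t \<in> {a<..<b} \<longrightarrow> (\<exists>d\<le>0. (g has_real_derivative d) (at t))"
  shows "g b \<le> g a"
proof -
  from deriv obtain N0 where N0: "N0 \<in> null_sets lebesgue"
    and N0d: "{t. \<not> (t \<in> {a<..<b} \<longrightarrow> (\<exists>d\<le>0. (g has_real_derivative d) (at t)))} \<subseteq> N0"
    unfolding eventually_ae_filter by auto
  \<comment> \<open>The endpoints join the null set because the derivative hypothesis covers the
    open interval only.\<close>
  define N where "N = N0 \<union> {a, b}"
  have N: "N \<in> null_sets lebesgue"
  proof -
    have "{a, b} \<in> null_sets lebesgue"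
      by (intro null_sets_completionI finite_imp_null_set_lborel) auto
    with N0 show ?thesis unfolding N_def by (rule null_sets.Un)
  qed
  have Nd: "\<exists>d\<le>0. (g has_real_derivative d) (at t)" if "t \<in> {a..b}" "t \<notin> N" for t
    using that N0d unfolding N_def by (auto simp: subset_iff) (metis less_le)
  \<comment> \<open>The term \<open>e * (b - a)\<close> pays for the differentiability points, the
    extra \<open>e\<close> for the tags in \<open>N\<close>.\<close>
  have main: "g b - g a \<le> e * (b - a) + e" if e: "e > 0" for e
  proof -
    obtain \<delta> where "\<delta> > 0" and \<delta>: "\<And>D.
        short_family a b \<delta> D
        \<Longrightarrow> (\<Sum>(s, t)\<in>D. dist (g s) (g t)) < e"
      using ac e unfolding abs_continuous_on_iff by metis
    obtain G where G: "open G" "N \<subseteq> G" "(G - N) \<in> lmeasurable"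
      "emeasure lebesgue (G - N) < ennreal \<delta>"
      using sets_lebesgue_outer_open[of N \<delta>] N \<open>\<delta> > 0\<close> by auto
    have NG: "G = (G - N) \<union> N" using G by auto
    have emG: "emeasure lebesgue G = emeasure lebesgue (G - N)"
      by (subst NG, rule emeasure_Un_null_set) (use G N in auto)
    have Gm: "G \<in> lmeasurable"
      using G emG by (auto simp: fmeasurable_def)
    have Gd: "measure lebesgue G < \<delta>"
      using G(4) emG \<open>\<delta> > 0\<close> Gm
      by (metis emeasure_eq_measure2 ennreal_less_iff measure_nonneg)
    \<comment> \<open>The endpoints straddle the tag t, so the two linearization errors add up to
      \<open>e * (z - y)\<close> instead of depending on the distance to t.\<close>
    have "\<exists>r>0. (t \<in> N \<longrightarrow> ball t r \<subseteq> G) \<and> (t \<in> {a..b} - N \<longrightarrow>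
      (\<forall>y z. y \<le> t \<longrightarrow> t \<le> z \<longrightarrow> y \<in> ball t r \<longrightarrow> z \<in> ball t r \<longrightarrow> g z - g y \<le> e * (z - y)))" for t
    proof (cases "t \<in> N")
      case True then show ?thesis using G by (meson Diff_iff openE subsetD)
    next
      case notN: False
      show ?thesis
      proof (cases "t \<in> {a..b}")
        case True
        obtain d where d: "d \<le> 0" "(g has_real_derivative d) (at t)" using Nd[OF True notN] by auto
        obtain r where r: "r > 0" "\<And>y. norm (y - t) < r \<Longrightarrow> norm (g y - g t - (y - t) * d) \<le> e * norm (y - t)"
          using d(2)[unfolded has_field_derivative_def has_derivative_at_alt] e
          by (metis mult.commute)
        have "g z - g y \<le> e * (z - y)" if "y \<le> t" "t \<le> z" "y \<in> ball t r" "z \<in> ball t r" for y z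
        proof -
          have "norm (g z - g t - (z - t) * d) \<le> e * norm (z - t)" "norm (g y - g t - (y - t) * d) \<le> e * norm (y - t)"
            using r(2)[of z] r(2)[of y] that by (auto simp: dist_real_def)
          moreover have "(z - t) * d \<le> 0" "(y - t) * d \<ge> 0"
            using that d by (auto simp: mult_nonneg_nonpos mult_nonpos_nonpos)
          ultimately have "g z - g t \<le> e * (z - t)" "g y - g t \<ge> - (e * (t - y))"
            using that by auto
          then show ?thesis by (simp add: algebra_simps)
        qed
        then show ?thesis using r(1) notN by blast
      next
        case False then show ?thesis using notN by (intro exI[of _ 1]) auto
      qed
    qed
    then obtain r where r: "\<And>t. r t > 0" "\<And>t. t \<in> N \<Longrightarrow> ball t (r t) \<subseteq> G"
       "\<And>t y z. t \<in> {a..b} - N \<Longrightarrow> y \<le> t \<Longrightarrow> t \<le> z \<Longrightarrow> y \<in> ball t (r t) \<Longrightarrow> z \<in> ball t (r t) \<Longrightarrow> g z - g y \<le> e * (z - y)"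
      by metis
    have "gauge (\<lambda>t. ball t (r t))" using r(1) by (intro gauge_ball_dependent) auto
    then obtain p where p: "p tagged_division_of {a..b}" and fine: "(\<lambda>t. ball t (r t)) fine p"
      using fine_division_exists_real by blast
    note pD = tagged_division_ofD[OF p]
    have pk: "k = {Inf k..Sup k} \<and> Inf k \<le> x \<and> x \<le> Sup k \<and> a \<le> Inf k \<and> Sup k \<le> b \<and> {Inf k..Sup k} \<subseteq> ball x (r x)"
      if xk: "(x,k) \<in> p" for x k
    proof -
      obtain u v where k: "k = {u..v}" using pD(4)[OF xk] by auto
      have "x \<in> k" "k \<subseteq> {a..b}" "k \<subseteq> ball x (r x)" using pD(2,3)[OF xk] fineD[OF fine xk] by auto
      moreover from this have "Inf k = u" "Sup k = v" using k by auto
      ultimately show ?thesis using k by auto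
    qed
    \<comment> \<open>Degenerate intervals are dropped: absolute continuity is about sets of
      endpoint pairs, and disjoint interiors force distinct pairs only if the interiors are
      nonempty.\<close>
    define E where "E = {(x,k)\<in>p. x \<in> N \<and> Inf k < Sup k}"
    have Ep: "E \<subseteq> p" unfolding E_def by auto
    then have finE: "finite E" using pD(1) finite_subset by blast
    define h where "h = (\<lambda>(x::real,k::real set). (Inf k, Sup k))"
    have disj: "disjnt {Inf k<..<Sup k} {Inf k'<..<Sup k'}"
      if "(x,k) \<in> E" "(x',k') \<in> E" "(x,k) \<noteq> (x',k')" for x k x' k'
    proof -
      have "interior k \<inter> interior k' = {}" using pD(5) that Ep by blast
      moreover have "interior k = {Inf k<..<Sup k}" "interior k' = {Inf k'<..<Sup k'}"
        using pk that Ep by (metis interior_atLeastAtMost_real subsetD)+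
      ultimately show ?thesis by (simp add: disjnt_def)
    qed
    have inj: "inj_on h E"
    proof (rule inj_onI)
      fix w w' assume w: "w \<in> E" "w' \<in> E" "h w = h w'"
      obtain x k x' k' where [simp]: "w = (x,k)" "w' = (x',k')" by fastforce
      show "w = w'"
      proof (rule ccontr)
        assume "w \<noteq> w'"
        then have "{Inf k<..<Sup k} \<inter> {Inf k'<..<Sup k'} = {}"
          using disj[of x k x' k'] w by (auto simp: disjnt_def)
        moreover have "Inf k = Inf k'" "Sup k = Sup k'" using w(3) by (auto simp: h_def)
        moreover have "Inf k < Sup k" using w(1) by (auto simp: E_def)
        ultimately show False by auto
      qed
    qed
    have "(\<Sum>(s, t)\<in>h ` E. dist (g s) (g t)) < e"
    proof (rule \<delta>, unfold short_family_def, intro conjI)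
      show "finite (h ` E)" using finE by auto
      show "\<forall>(s, t)\<in>h ` E. a \<le> s \<and> s \<le> t \<and> t \<le> b"
        using Ep pk by (fastforce simp: h_def)
      show "pairwise (\<lambda>I I'. disjnt {fst I<..<snd I} {fst I'<..<snd I'}) (h ` E)"
        unfolding pairwise_def using disj by (fastforce simp: h_def)
      have "(\<Sum>(s, t)\<in>h ` E. t - s) = (\<Sum>(x,k)\<in>E. Sup k - Inf k)"
        by (subst sum.reindex[OF inj]) (auto simp: h_def case_prod_unfold)
      also have "\<dots> = (\<Sum>w\<in>E. measure lebesgue {Inf (snd w)<..<Sup (snd w)})"
        by (rule sum.cong) (auto simp: E_def)
      also have "\<dots> = measure lebesgue (\<Union>w\<in>E. {Inf (snd w)<..<Sup (snd w)})"
      proof (rule measure_UNION'[symmetric])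
        show "pairwise (\<lambda>w w'. disjnt {Inf (snd w)<..<Sup (snd w)} {Inf (snd w')<..<Sup (snd w')}) E"
        proof (rule pairwiseI)
          fix w w' assume "w \<in> E" "w' \<in> E" "w \<noteq> w'"
          then show "disjnt {Inf (snd w)<..<Sup (snd w)} {Inf (snd w')<..<Sup (snd w')}"
            using disj[of "fst w" "snd w" "fst w'" "snd w'"] by simp
        qed
      qed (use finE in auto)
      also have "\<dots> \<le> measure lebesgue G"
      proof (rule measure_mono_fmeasurable)
        show "(\<Union>w\<in>E. {Inf (snd w)<..<Sup (snd w)}) \<subseteq> G"
        proof clarsimp
          fix x k t assume "(x,k) \<in> E" and t: "Inf k < t" "t < Sup k"
          then have "x \<in> N" "(x,k) \<in> p" by (auto simp: E_def)
          then have "{Inf k..Sup k} \<subseteq> G" using r(2) pk by blast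
          then show "t \<in> G" using t by auto
        qed
      qed (use finE Gm in auto)
      finally show "(\<Sum>(s, t)\<in>h ` E. t - s) < \<delta>" using Gd by simp
    qed
    moreover have "(\<Sum>(s, t)\<in>h ` E. dist (g s) (g t)) = (\<Sum>(x,k)\<in>E. \<bar>g (Sup k) - g (Inf k)\<bar>)"
      by (subst sum.reindex[OF inj]) (auto simp: h_def case_prod_unfold dist_real_def abs_minus_commute)
    ultimately have Esum: "(\<Sum>(x,k)\<in>E. \<bar>g (Sup k) - g (Inf k)\<bar>) < e" by simp
    have "g b - g a = (\<Sum>(x,k)\<in>p. g (Sup k) - g (Inf k))"
      by (rule additive_tagged_division_1[OF ab p, symmetric])
    also have "\<dots> \<le> (\<Sum>w\<in>p. e * (case w of (x,k) \<Rightarrow> Sup k - Inf k) +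
        (if w \<in> E then case w of (x,k) \<Rightarrow> \<bar>g (Sup k) - g (Inf k)\<bar> else 0))"
    proof (rule sum_mono, clarify)
      fix x k assume xk: "(x,k) \<in> p"
      note k = pk[OF xk]
      show "g (Sup k) - g (Inf k) \<le> e * (Sup k - Inf k) + (if (x,k) \<in> E then \<bar>g (Sup k) - g (Inf k)\<bar> else 0)"
      proof (cases "x \<in> N")
        case True
        then show ?thesis using e k xk unfolding E_def
          by (cases "Inf k = Sup k") (auto simp: add_increasing)
      next
        case False
        have "{Inf k..Sup k} \<subseteq> ball x (r x)" "Inf k \<le> Sup k" using k by auto
        then have "Inf k \<in> ball x (r x)" "Sup k \<in> ball x (r x)" by (meson atLeastAtMost_iff order_refl subsetD)+
        then have "g (Sup k) - g (Inf k) \<le> e * (Sup k - Inf k)"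
          using k False by (intro r(3)[of x]) auto
        then show ?thesis by auto
      qed
    qed
    also have "\<dots> = e * (\<Sum>(x,k)\<in>p. Sup k - Inf k) + (\<Sum>w\<in>E. case w of (x,k) \<Rightarrow> \<bar>g (Sup k) - g (Inf k)\<bar>)"
      using pD(1) Ep by (simp add: sum.distrib sum_distrib_left sum.If_cases Int_absorb1 Collect_mem_eq)
    also have "(\<Sum>(x,k)\<in>p. Sup k - Inf k) = b - a"
      by (rule additive_tagged_division_1[OF ab p])
    finally show ?thesis using Esum by simp
  qed
  show ?thesis
  proof (rule ccontr)
    assume "\<not> g b \<le> g a"
    then have pos: "g b - g a > 0" by simp
    define k where "k = b - a + 1"
    define e where "e = (g b - g a) / (2 * k)"
    have k: "k > 0" unfolding k_def using ab by simp
    have "e > 0" unfolding e_def using pos k by (auto intro!: divide_pos_pos)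
    moreover have "e * (b - a) + e = e * k" by (simp add: k_def algebra_simps)
    moreover have "e * k = (g b - g a) / 2" unfolding e_def using k by simp
    ultimately show False using main[of e] pos by simp
  qed
qed

text \<open>The Lipschitz bound is asked for on the range of \<open>x\<close> only, so that
  quadratic forms, which are only locally Lipschitz, are covered.\<close>

lemma abs_continuous_on_compose_lipschitz:
  fixes f :: "'a::metric_space \<Rightarrow> 'b::metric_space"
  assumes "abs_continuous_on a b x" and lip: "L-lipschitz_on (x ` {a..b}) f"
  shows "abs_continuous_on a b (\<lambda>t. f (x t))"
  unfolding abs_continuous_on_iff
proof (intro allI impI)
  fix e :: real assume "e > 0"
  have L0: "L \<ge> 0" using lip by (rule lipschitz_on_nonneg)
  then have "e / (L + 1) > 0" using \<open>e > 0\<close> by simp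
  then obtain d where d: "d > 0" and dD: "\<And>D.
        short_family a b d D
        \<Longrightarrow> (\<Sum>(s, t)\<in>D. dist (x s) (x t)) < e / (L + 1)"
    using assms(1) unfolding abs_continuous_on_iff by metis
  show "\<exists>d>0. \<forall>D.
        short_family a b d D
        \<longrightarrow> (\<Sum>(s, t)\<in>D. dist (f (x s)) (f (x t))) < e"
  proof (intro exI[of _ d] conjI d allI impI)
    fix D :: "(real \<times> real) set"
    assume D: "short_family a b d D"
    have "(\<Sum>(s, t)\<in>D. dist (f (x s)) (f (x t))) \<le> (\<Sum>(s, t)\<in>D. (L + 1) * dist (x s) (x t))"
    proof (rule sum_mono, clarify)
      fix s t assume "(s,t) \<in> D"
      then have "s \<in> {a..b}" "t \<in> {a..b}" using D by (auto simp: short_family_def)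
      then have "dist (f (x s)) (f (x t)) \<le> L * dist (x s) (x t)"
        using lipschitz_onD[OF lip] by auto
      then show "dist (f (x s)) (f (x t)) \<le> (L + 1) * dist (x s) (x t)"
        by (simp add: distrib_right add_increasing2)
    qed
    also have "\<dots> = (L + 1) * (\<Sum>(s, t)\<in>D. dist (x s) (x t))"
      by (simp add: sum_distrib_left case_prod_unfold)
    also have "\<dots> < e" using dD[OF D] L0 by (simp add: field_simps)
    finally show "(\<Sum>(s, t)\<in>D. dist (f (x s)) (f (x t))) < e" .
  qed
qed

lemma abs_continuous_on_id: "abs_continuous_on a b (\<lambda>t. t)"
  unfolding abs_continuous_on_iff
proof (intro allI impI)
  fix e :: real assume "e > 0"
  show "\<exists>\<delta>>0. \<forall>D.
        short_family a b \<delta> D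
        \<longrightarrow> (\<Sum>(s, t)\<in>D. dist s t) < e"
  proof (intro exI[of _ e] conjI \<open>e > 0\<close> allI impI)
    fix D assume "short_family a b e D"
    then have D: "\<forall>(s, t)\<in>D. a \<le> s \<and> s \<le> t \<and> t \<le> b" "(\<Sum>(s, t)\<in>D. t - s) < e"
      by (auto simp: short_family_def)
    have "(\<Sum>(s, t)\<in>D. dist s t) = (\<Sum>(s, t)\<in>D. t - s)"
      by (rule sum.cong) (use D in \<open>auto simp: dist_real_def\<close>)
    with D show "(\<Sum>(s, t)\<in>D. dist s t) < e" by simp
  qed
qed

lemma lipschitz_on_imp_abs_continuous_on:
  fixes f :: "real \<Rightarrow> 'b::metric_space"
  assumes "L-lipschitz_on {a..b} f"
  shows "abs_continuous_on a b f"
  using abs_continuous_on_compose_lipschitz[OF abs_continuous_on_id, where f=f and L=L] assms by simp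

lemma abs_continuous_on_subinterval:
  assumes "abs_continuous_on a b f" "a \<le> c" "d \<le> b"
  shows "abs_continuous_on c d f"
  unfolding abs_continuous_on_iff
proof (intro allI impI)
  fix e :: real assume "e > 0"
  then obtain \<delta> where \<delta>: "\<delta> > 0" and D: "\<And>D.
        short_family a b \<delta> D
        \<Longrightarrow> (\<Sum>(s, t)\<in>D. dist (f s) (f t)) < e"
    using assms(1) unfolding abs_continuous_on_iff by metis
  show "\<exists>\<delta>>0. \<forall>D.
        short_family c d \<delta> D
        \<longrightarrow> (\<Sum>(s, t)\<in>D. dist (f s) (f t)) < e"
    by (intro exI[of _ \<delta>] conjI \<delta> allI impI, rule D) (use assms(2,3) in \<open>force simp: short_family_def\<close>)
qed

lemma abs_continuous_on_imp_continuous_on: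
  assumes "abs_continuous_on a b f"
  shows "continuous_on {a..b} f"
  unfolding continuous_on_iff
proof (intro ballI allI impI)
  fix x e :: real assume x: "x \<in> {a..b}" and "e > 0"
  then obtain \<delta> where \<delta>: "\<delta> > 0" and D: "\<And>D.
        short_family a b \<delta> D
        \<Longrightarrow> (\<Sum>(s, t)\<in>D. dist (f s) (f t)) < e"
    using assms(1) unfolding abs_continuous_on_iff by metis
  show "\<exists>d>0. \<forall>x'\<in>{a..b}. dist x' x < d \<longrightarrow> dist (f x') (f x) < e"
  proof (intro exI[of _ \<delta>] conjI \<delta> ballI impI)
    fix y assume y: "y \<in> {a..b}" "dist y x < \<delta>"
    show "dist (f y) (f x) < e"
      using D[of "{(min x y, max x y)}"] x y
      by (cases "x \<le> y") (auto simp: short_family_def dist_real_def dist_commute)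
  qed
qed

subsection \<open>Dissipative systems\<close>

text \<open>The constant is the minimum over the compact unit sphere of \<open>V\<close>, extended
  by homogeneity. Symmetry is not assumed, so the lemma also applies to
  \<open>- p x (gen y)\<close>.\<close>

lemma bilinear_pos_coercive:
  fixes b :: "'a::euclidean_space \<Rightarrow> 'a \<Rightarrow> real"
  assumes bil: "bilinear b" and V: "subspace V"
    and pos: "\<And>x. x \<in> V \<Longrightarrow> x \<noteq> 0 \<Longrightarrow> 0 < b x x"
  obtains c where "c > 0" "\<And>x. x \<in> V \<Longrightarrow> c * (norm x)\<^sup>2 \<le> b x x"
proof (cases "V \<inter> sphere 0 1 = {}")
  case True
  have "x = 0" if "x \<in> V" for x
  proof (rule ccontr)
    assume "x \<noteq> 0"
    then have "(1 / norm x) *\<^sub>R x \<in> V \<inter> sphere 0 1"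
      using that V by (auto simp: subspace_scale)
    with True show False by auto
  qed
  then show ?thesis
    using that[of 1] bilinear_lzero[OF bil] by fastforce
next
  case False
  interpret bounded_bilinear b using bil by (simp add: bilinear_conv_bounded_bilinear)
  have comp: "compact (V \<inter> sphere 0 1)"
    by (simp add: V closed_Int_compact closed_subspace)
  have "continuous_on (V \<inter> sphere 0 1) (\<lambda>x. b x x)"
    by (intro continuous_on continuous_on_id)
  from continuous_attains_inf[OF comp False this] obtain x0 where
    x0: "x0 \<in> V" "norm x0 = 1" and min: "\<And>y. y \<in> V \<Longrightarrow> norm y = 1 \<Longrightarrow> b x0 x0 \<le> b y y"
    by auto
  show ?thesis
  proof (rule that[of "b x0 x0"])
    show "b x0 x0 > 0" using pos x0 by force
    fix x assume x: "x \<in> V"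
    show "b x0 x0 * (norm x)\<^sup>2 \<le> b x x"
    proof (cases "x = 0")
      case False
      let ?y = "(1 / norm x) *\<^sub>R x"
      have "b x0 x0 \<le> b ?y ?y"
        using False x V by (intro min) (auto simp: subspace_scale)
      also have "\<dots> = b x x / (norm x)\<^sup>2"
        by (simp add: scaleR_left scaleR_right power2_eq_square)
      finally show ?thesis using False by (simp add: field_simps)
    qed (simp add: zero_left)
  qed
qed

text \<open>The equality case of Cauchy-Schwarz for a semidefinite form: a zero of the quadratic
  form is a minimum, so the first variation vanishes there.\<close>

lemma bilinear_psd_null:
  fixes b :: "'a::real_vector \<Rightarrow> 'a \<Rightarrow> real"
  assumes bil: "bilinear b" and sym: "\<And>x y. b x y = b y x" and V: "subspace V"
    and psd: "\<And>x. x \<in> V \<Longrightarrow> 0 \<le> b x x"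
    and x: "x \<in> V" "b x x = 0" and y: "y \<in> V"
  shows "b x y = 0"
proof -
  \<comment> \<open>Up to the summand 1 this is the minimizer of the quadratic in t; the 1 avoids a
    separate case \<open>b y y = 0\<close>.\<close>
  define t where "t = - b x y / (b y y + 1)"
  have d: "b y y + 1 > 0" using psd[OF y] by simp
  have "x + t *\<^sub>R y \<in> V" using V x y by (simp add: subspace_add subspace_scale)
  then have "0 \<le> b (x + t *\<^sub>R y) (x + t *\<^sub>R y)" by (rule psd)
  also have "\<dots> = 2 * t * b x y + t\<^sup>2 * b y y"
    using bil x sym[of y x]
    by (simp add: bilinear_ladd bilinear_radd bilinear_lmul bilinear_rmul power2_eq_square)
  also have "\<dots> = - ((b x y)\<^sup>2 * (b y y + 2) / (b y y + 1)\<^sup>2)"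
    using d unfolding t_def by (simp add: power2_eq_square divide_simps) (simp add: algebra_simps)
  finally have "(b x y)\<^sup>2 * (b y y + 2) / (b y y + 1)\<^sup>2 \<le> 0" by simp
  then have "(b x y)\<^sup>2 * (b y y + 2) \<le> 0"
    using d by (simp add: divide_le_0_iff)
  then show ?thesis using psd[OF y] by (simp add: mult_le_0_iff)
qed

lemma linear_inj_on_subspace_image_eq:
  fixes f :: "'a::euclidean_space \<Rightarrow> 'a"
  assumes "linear f" "subspace V" "f ` V \<subseteq> V" "\<And>x. x \<in> V \<Longrightarrow> f x = 0 \<Longrightarrow> x = 0"
  shows "f ` V = V"
proof (rule subspace_dim_equal)
  have "inj_on f V"
    using assms by (metis linear_inj_on_iff_eq_0)
  then have "inj_on f (span V)" using assms(2) by (simp add: span_eq_iff[THEN iffD2])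
  then show "dim V \<le> dim (f ` V)" using dim_image_eq[OF assms(1)] by simp
qed (use assms in \<open>auto simp: linear_subspace_image\<close>)

text \<open>Coordinate-free setting: \<open>ip\<close> stands for the Q-weighted inner product,
  \<open>K\<close> for \<open>J ** Q\<close> and \<open>S\<close> for \<open>R ** Q\<close>.\<close>

locale dissipative_system =
  fixes ip :: "'a::euclidean_space \<Rightarrow> 'a \<Rightarrow> real" and K S :: "'a \<Rightarrow> 'a"
  assumes bil: "bilinear ip"
    and ip_sym: "ip x y = ip y x"
    and ip_pos: "x \<noteq> 0 \<Longrightarrow> 0 < ip x x"
    and linear_K: "linear K" and linear_S: "linear S"
    and K_skew: "ip (K x) y = - ip x (K y)"
    and S_sym: "ip (S x) y = ip x (S y)"
    and S_psd: "0 \<le> ip x (S x)"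
begin

definition gen where "gen x = K x - S x"

text \<open>The two equations for \<open>K\<close> say that a + ib is an eigenvector for the
  eigenvalue i\<alpha>, in real form. They are posed for \<open>K\<close> with \<open>S\<close>
  vanishing; \<open>conservative_subspace_eq\<close> shows that the imaginary eigenvectors of
  \<open>gen\<close> give the same space.\<close>

definition cons where
  "cons = span {a. \<exists>b \<alpha>. K a = - (\<alpha> *\<^sub>R b) \<and> K b = \<alpha> *\<^sub>R a \<and> S a = 0 \<and> S b = 0}"

definition diss where "diss = {x. \<forall>y\<in>cons. ip x y = 0}"

sublocale ip: bounded_bilinear ip
  using bil by (simp add: bilinear_conv_bounded_bilinear)

lemma linear_gen: "linear gen"
  unfolding gen_def[abs_def] by (intro linear_compose_sub linear_K linear_S)

lemma ip_nonneg: "0 \<le> ip x x"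
  using ip_pos[of x] ip.zero_left[of x] by (cases "x = 0") auto

lemma ip_self_eq_0: "ip x x = 0 \<longleftrightarrow> x = 0"
  using ip_pos[of x] ip.zero_left[of x] by (cases "x = 0") auto

lemma ip_K_self: "ip x (K x) = 0"
  using K_skew[of x x] ip_sym[of x "K x"] by simp

lemma ip_gen_self: "ip x (gen x) = - ip x (S x)"
  by (simp add: gen_def ip.diff_right ip_K_self)

text \<open>Cauchy-Schwarz for the semidefinite form \<open>ip x (S y)\<close>, tested with
  \<open>y = S x\<close>.\<close>

lemma S_eq_0: assumes "ip x (S x) = 0" shows "S x = 0"
proof -
  have "bilinear (\<lambda>x y. ip x (S y))"
    unfolding bilinear_def
    by (intro conjI allI linearI)
       (auto simp: ip.add_left ip.add_right ip.scaleR_left ip.scaleR_right linear_add[OF linear_S] linear_scale[OF linear_S])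
  moreover have "ip y (S z) = ip z (S y)" for y z
    using S_sym[of y z] ip_sym[of "S y" z] by simp
  ultimately have "ip x (S (S x)) = 0"
    using bilinear_psd_null[of "\<lambda>x y. ip x (S y)" UNIV x "S x"] assms S_psd by simp
  then show ?thesis using S_sym[of x "S x"] ip_self_eq_0 by simp
qed

lemma subspace_cons: "subspace cons" unfolding cons_def by simp

lemma S_cons: assumes "x \<in> cons" shows "S x = 0"
  using assms unfolding cons_def
  by (induction rule: span_induct) (auto simp: subspace_def linear_0 linear_add linear_scale linear_S)

lemma cons_I:
  assumes "K a = - (\<alpha> *\<^sub>R b)" "K b = \<alpha> *\<^sub>R a" "S a = 0" "S b = 0"
  shows "a \<in> cons"
  unfolding cons_def using assms by (intro span_base) auto

text \<open>Multiplying the eigenvector a + ib by -i gives b - ia, so the pair (b, -a) qualifies as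
  well.\<close>

lemma cons_I2:
  assumes "K a = - (\<alpha> *\<^sub>R b)" "K b = \<alpha> *\<^sub>R a" "S a = 0" "S b = 0"
  shows "b \<in> cons"
  by (rule cons_I[of b \<alpha> "-a"]) (use assms in \<open>auto simp: linear_neg linear_K linear_S\<close>)

lemma K_cons: assumes "x \<in> cons" shows "K x \<in> cons"
  using assms unfolding cons_def
proof (induction rule: span_induct)
  case base
  show ?case
    using subspace_span[of "{a. \<exists>b \<alpha>. K a = - (\<alpha> *\<^sub>R b) \<and> K b = \<alpha> *\<^sub>R a \<and> S a = 0 \<and> S b = 0}"] linear_K
    by (auto simp: subspace_def linear_0 linear_add linear_scale)
next
  case (step a)
  then obtain b \<alpha> where *: "K a = - (\<alpha> *\<^sub>R b)" "K b = \<alpha> *\<^sub>R a" "S a = 0" "S b = 0" by auto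
  then have "b \<in> cons" by (rule cons_I2)
  then have "- (\<alpha> *\<^sub>R b) \<in> cons" using subspace_cons by (simp add: subspace_neg subspace_scale)
  then show ?case using * unfolding cons_def by simp
qed

section \<open>The orthogonal complement and the two projections\<close>

lemma subspace_diss: "subspace diss"
  unfolding diss_def subspace_def by (auto simp: ip.add_left ip.scaleR_left ip.zero_left)

lemma K_diss: "x \<in> diss \<Longrightarrow> K x \<in> diss"
  unfolding diss_def using K_cons by (auto simp: K_skew)

lemma S_diss: "x \<in> diss \<Longrightarrow> S x \<in> diss"
  unfolding diss_def using S_cons by (auto simp: S_sym ip.zero_right)

lemma gen_diss: "x \<in> diss \<Longrightarrow> gen x \<in> diss"
  unfolding gen_def using K_diss S_diss subspace_diss by (simp add: subspace_diff)

lemma cons_Int_diss: "x \<in> cons \<Longrightarrow> x \<in> diss \<Longrightarrow> x = 0"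
  unfolding diss_def using ip_self_eq_0 by auto

text \<open>The operator \<Psi> replaces an orthonormal basis: independence of \<open>B\<close>
  makes its kernel lie in \<open>diss\<close>, so it is bijective on \<open>cons\<close>, and y is
  the element of \<open>cons\<close> with the same image as x.\<close>

lemma cons_diss_decomp:
  obtains y where "y \<in> cons" "x - y \<in> diss"
proof -
  obtain B where B: "B \<subseteq> cons" "independent B" "cons \<subseteq> span B" "card B = dim cons"
    by (rule basis_exists)
  have finB: "finite B" using B(2) by (rule independent_imp_finite)
  define \<Psi> where "\<Psi> = (\<lambda>x. \<Sum>b\<in>B. ip x b *\<^sub>R b)"
  have lin: "linear \<Psi>"
    unfolding \<Psi>_def
    by (rule linearI) (auto simp: ip.add_left ip.scaleR_left scaleR_add_left sum.distrib scaleR_sum_right)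
  have \<Psi>cons: "\<Psi> x \<in> cons" for x
    unfolding \<Psi>_def using B(1) subspace_cons by (intro subspace_sum subspace_scale) auto
  have orth: "x \<in> diss" if "\<Psi> x = 0" for x
  proof -
    have "\<forall>b\<in>B. ip x b = 0"
      using independentD[OF B(2) finB subset_refl] that unfolding \<Psi>_def by blast
    have "ip x y = 0" if "y \<in> span B" for y
      using that by (induction rule: span_induct)
        (use \<open>\<forall>b\<in>B. ip x b = 0\<close> in \<open>auto simp: subspace_def ip.add_right ip.scaleR_right ip.zero_right\<close>)
    then show ?thesis using B(3) unfolding diss_def by auto
  qed
  have "\<Psi> ` cons = cons"
    using orth \<Psi>cons ip_self_eq_0
    by (intro linear_inj_on_subspace_image_eq lin subspace_cons) (auto simp: diss_def)
  then obtain y where y: "y \<in> cons" "\<Psi> x = \<Psi> y" using \<Psi>cons[of x] by blast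
  then have "\<Psi> (x - y) = 0" by (simp add: linear_diff[OF lin])
  with y that orth show ?thesis by blast
qed

lemma cons_diss_decomp_unique:
  assumes "y \<in> cons" "x - y \<in> diss" "y' \<in> cons" "x - y' \<in> diss"
  shows "y = y'"
proof -
  have "y - y' \<in> cons" using assms subspace_cons by (simp add: subspace_diff)
  moreover have "(x - y') - (x - y) \<in> diss" using assms subspace_diss by (blast intro: subspace_diff)
  then have "y - y' \<in> diss" by simp
  ultimately show ?thesis using cons_Int_diss by force
qed

lemma proj_cons:
  shows proj_cons_in: "proj_along cons diss x \<in> cons" and proj_cons_diff: "x - proj_along cons diss x \<in> diss"
proof -
  obtain y where "y \<in> cons" "x - y \<in> diss" by (rule cons_diss_decomp)
  then have "\<exists>!y. y \<in> cons \<and> x - y \<in> diss" using cons_diss_decomp_unique by blast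
  from theI'[OF this] show "proj_along cons diss x \<in> cons" "x - proj_along cons diss x \<in> diss"
    unfolding proj_along_def by auto
qed

lemma proj_cons_eqI: "y \<in> cons \<Longrightarrow> x - y \<in> diss \<Longrightarrow> proj_along cons diss x = y"
  using cons_diss_decomp_unique proj_cons by blast

lemma proj_diss_eq: "proj_along diss cons x = x - proj_along cons diss x"
  unfolding proj_along_def[of diss]
proof (rule the_equality)
  show "x - proj_along cons diss x \<in> diss \<and> x - (x - proj_along cons diss x) \<in> cons" using proj_cons by simp
  show "y = x - proj_along cons diss x" if "y \<in> diss \<and> x - y \<in> cons" for y
    using proj_cons_eqI[of "x - y" x] that by simp
qed

lemma linear_proj_cons: "linear (proj_along cons diss)"
proof (rule linearI)
  fix x y r
  have "x + y - (proj_along cons diss x + proj_along cons diss y) = (x - proj_along cons diss x) + (y - proj_along cons diss y)"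
    by simp
  also have "\<dots> \<in> diss" using proj_cons subspace_diss by (blast intro: subspace_add)
  finally show "proj_along cons diss (x + y) = proj_along cons diss x + proj_along cons diss y"
    using proj_cons subspace_cons by (intro proj_cons_eqI) (auto intro: subspace_add)
  have "r *\<^sub>R x - r *\<^sub>R proj_along cons diss x = r *\<^sub>R (x - proj_along cons diss x)"
    by (simp add: scaleR_diff_right)
  also have "\<dots> \<in> diss" using proj_cons subspace_diss by (blast intro: subspace_scale)
  finally show "proj_along cons diss (r *\<^sub>R x) = r *\<^sub>R proj_along cons diss x"
    using proj_cons subspace_cons by (intro proj_cons_eqI) (auto intro: subspace_scale)
qed

lemma proj_cons_id: "x \<in> cons \<Longrightarrow> proj_along cons diss x = x"
  using subspace_0[OF subspace_diss] by (intro proj_cons_eqI) auto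

lemma ip_proj_cons: "y \<in> cons \<Longrightarrow> ip (proj_along cons diss x) y = ip x y"
  using proj_cons_diff[of x] ip.diff_left[of x "proj_along cons diss x" y] unfolding diss_def by auto

text \<open>A maximiser of the Rayleigh quotient of \<open>- K\<^sup>2\<close> on \<open>Z\<close> spans, together with its image
  under \<open>K\<close>, a plane (or line) contained in \<open>cons\<close>.\<close>

lemma skew_invariant_trivial:
  assumes Z: "subspace Z" "Z \<subseteq> diss" and KZ: "\<And>z. z \<in> Z \<Longrightarrow> K z \<in> Z" and SZ: "\<And>z. z \<in> Z \<Longrightarrow> S z = 0"
    and "z \<in> Z"
  shows "z = 0"
proof (rule ccontr)
  assume "z \<noteq> 0"
  obtain m where m: "m > 0" "\<And>x. m * (norm x)\<^sup>2 \<le> ip x x"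
    using bilinear_pos_coercive[OF bil subspace_UNIV] ip_pos by auto
  define X where "X = {x \<in> Z. ip x x = 1}"
  have "(1 / sqrt (ip z z)) *\<^sub>R z \<in> X"
    using \<open>z \<in> Z\<close> Z ip_pos[OF \<open>z \<noteq> 0\<close>] unfolding X_def
    by (auto simp: subspace_scale ip.scaleR_left ip.scaleR_right)
  then have "X \<noteq> {}" by auto
  have Kbl: "bounded_linear K" using linear_K by (simp add: linear_conv_bounded_linear)
  have comp: "compact X"
    unfolding compact_eq_bounded_closed
  proof
    have "norm x \<le> sqrt (1 / m)" if "x \<in> X" for x
    proof (rule real_le_rsqrt)
      show "(norm x)\<^sup>2 \<le> 1 / m" using m(2)[of x] that m(1) by (simp add: X_def field_simps)
    qed
    then show "bounded X" unfolding bounded_iff by blast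
    have "closed (Z \<inter> {x. ip x x = 1})"
      by (intro closed_Int closed_subspace Z closed_Collect_eq ip.continuous_on continuous_intros)
    moreover have "X = Z \<inter> {x. ip x x = 1}" by (auto simp: X_def)
    ultimately show "closed X" by simp
  qed
  have "continuous_on X (\<lambda>x. ip (K x) (K x))"
    by (intro ip.continuous_on bounded_linear.continuous_on[OF Kbl] continuous_on_id)
  from continuous_attains_sup[OF comp \<open>X \<noteq> {}\<close> this]
  obtain a where a: "a \<in> X" and amax: "\<And>y. y \<in> X \<Longrightarrow> ip (K y) (K y) \<le> ip (K a) (K a)"
    by auto
  have aZ: "a \<in> Z" "ip a a = 1" using a by (auto simp: X_def)
  define l where "l = ip (K a) (K a)"
  have l0: "l \<ge> 0" unfolding l_def by (rule ip_nonneg)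
  \<comment> \<open>Maximality of \<open>a\<close> makes this form semidefinite on \<open>Z\<close>
    with \<open>b a a = 0\<close>, hence \<open>b a v = 0\<close> for all v in
    \<open>Z\<close>.\<close>
  define b where "b = (\<lambda>x y. l * ip x y - ip (K x) (K y))"
  have bilb: "bilinear b"
    unfolding bilinear_def b_def
    by (intro conjI allI linearI)
       (auto simp: ip.add_left ip.add_right ip.scaleR_left ip.scaleR_right linear_add[OF linear_K] linear_scale[OF linear_K] algebra_simps)
  have bpsd: "0 \<le> b x x" if "x \<in> Z" for x
  proof (cases "x = 0")
    case False
    let ?y = "(1 / sqrt (ip x x)) *\<^sub>R x"
    have "?y \<in> X"
      using that Z ip_pos[OF False] unfolding X_def
      by (auto simp: subspace_scale ip.scaleR_left ip.scaleR_right)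
    from amax[OF this] have "ip (K x) (K x) / ip x x \<le> l"
      using ip_pos[OF False]
      by (simp add: l_def linear_scale[OF linear_K] ip.scaleR_left ip.scaleR_right)
    then show ?thesis using ip_pos[OF False] by (simp add: b_def field_simps)
  qed (simp add: b_def linear_0[OF linear_K] ip.zero_left)
  \<comment> \<open>The residual of the eigenvalue equation for \<open>K\<close> squared; by
    skewness \<open>b a v\<close> equals \<open>ip v v\<close>.\<close>
  define v where "v = l *\<^sub>R a + K (K a)"
  have vZ: "v \<in> Z" unfolding v_def using aZ KZ Z by (simp add: subspace_add subspace_scale)
  have "b a v = 0"
    using bilinear_psd_null[OF bilb _ Z(1) bpsd aZ(1) _ vZ] aZ(2)
    by (simp add: b_def l_def ip_sym)
  then have "ip v v = 0"
    unfolding b_def by (subst v_def) (simp add: ip.add_left ip.scaleR_left K_skew[of "K a"])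
  then have v: "K (K a) = - (l *\<^sub>R a)" by (simp add: ip_self_eq_0 v_def eq_neg_iff_add_eq_0 add.commute)
  have "a \<in> cons"
  proof (cases "l = 0")
    case True
    then have "K a = 0" using ip_self_eq_0 l_def by auto
    then show ?thesis using aZ SZ by (intro cons_I[of a 0 0]) (auto simp: linear_0 linear_K linear_S)
  next
    case False
    then have s: "sqrt l > 0" using l0 by simp
    show ?thesis
    proof (rule cons_I[of a "sqrt l" "- (1 / sqrt l) *\<^sub>R K a"])
      show "K (- (1 / sqrt l) *\<^sub>R K a) = sqrt l *\<^sub>R a"
        using l0 s v by (simp add: linear_scale[OF linear_K] linear_neg[OF linear_K] real_div_sqrt)
    qed (use s aZ SZ KZ in \<open>auto simp: linear_scale[OF linear_S] linear_neg[OF linear_S]\<close>)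
  qed
  then have "a = 0" using aZ Z cons_Int_diss by auto
  then show False using aZ ip.zero_left by auto
qed

end

subsection \<open>A strict Lyapunov form on the dissipative subspace\<close>

context dissipative_system begin

text \<open>The Cayley transform \<open>F = (I - gen)\<inverse>(I + gen)\<close> is an \<open>ip\<close>-contraction, and some power of it is
  strict on \<open>diss\<close>.  Summing \<open>ip\<close> along the orbit of \<open>F\<close> makes every single step strict;
  undoing the Cayley transform turns this into a strict Lyapunov inequality for \<open>gen\<close>.\<close>

lemma lyapunov_form:
  obtains p c where "bilinear p" "\<And>x y. p x y = p y x" "\<And>x. x \<noteq> 0 \<Longrightarrow> 0 < p x x"
    "c > 0" "\<And>x. x \<in> diss \<Longrightarrow> p x (gen x) \<le> - c * (norm x)\<^sup>2"
proof -
  define T where "T = (\<lambda>y. y - gen y)"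
  have linT: "linear T" unfolding T_def by (intro linear_compose_sub linear_ident linear_gen)
  have T0: "y = 0" if "T y = 0" for y
  proof -
    have "ip y y = - ip y (S y)" using that ip_gen_self[of y] by (simp add: T_def)
    then have "ip y y = 0" using S_psd[of y] ip_nonneg[of y] by simp
    then show ?thesis by (simp add: ip_self_eq_0)
  qed
  have "inj T" using T0 by (simp add: linear_inj_iff_eq_0[OF linT])
  then obtain G where linG: "linear G" and GT: "\<And>x. G (T x) = x" and TG: "\<And>x. T (G x) = x"
    using linear_injective_isomorphism[OF linT] by blast
  have "T ` diss = diss"
    using gen_diss subspace_diss T0
    by (intro linear_inj_on_subspace_image_eq linT) (auto simp: T_def subspace_diff)
  then have GD: "G x \<in> diss" if "x \<in> diss" for x using that GT by (metis imageE)
  \<comment> \<open>With \<open>x = T y\<close> this is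
    \<open>2 y - (y - gen y) = y + gen y\<close>, the Cayley transform.\<close>
  define F where "F = (\<lambda>x. 2 *\<^sub>R G x - x)"
  have linF: "linear F" unfolding F_def
    by (intro linear_compose_sub linear_ident linear_compose_scale_right linG)
  have FD: "F x \<in> diss" if "x \<in> diss" for x
    unfolding F_def using that GD subspace_diss by (simp add: subspace_diff subspace_scale)
  have FT: "F (T y) = y + gen y" for y by (simp add: F_def GT) (simp add: T_def scaleR_2)
  have linFk: "linear (F ^^ k)" for k
  proof (induction k)
    case 0 show ?case by (simp add: id_def linear_ident)
  next
    case (Suc k) then show ?case using linear_compose[OF Suc linF] by (simp add: o_def)
  qed
  have FkD: "(F ^^ k) x \<in> diss" if "x \<in> diss" for k x
    using that by (induction k) (auto intro: FD)
  \<comment> \<open>Energy balance of one step: the mixed terms of y - gen y and y + gen y leave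
    \<open>- 4 * ip y (gen y)\<close>, in which the skew part disappears.\<close>
  have drop: "ip x x - ip (F x) (F x) = 4 * ip (G x) (S (G x))" for x
  proof -
    define y where "y = G x"
    have "ip (T y) (T y) - ip (F (T y)) (F (T y)) = - 4 * ip y (gen y)"
      unfolding FT by (simp add: T_def ip.add_left ip.add_right ip.diff_left ip.diff_right ip_sym[of "gen y" y])
    then show ?thesis by (simp add: y_def TG ip_gen_self)
  qed
  have tele: "ip x x - ip ((F ^^ k) x) ((F ^^ k) x) = (\<Sum>j<k. 4 * ip (G ((F ^^ j) x)) (S (G ((F ^^ j) x))))" for k x
    by (induction k) (auto simp: drop[symmetric])
  \<comment> \<open>States whose first k steps lose no energy. These subspaces decrease in k, so at
    a k of least dimension the chain stops and \<open>Z k\<close> becomes invariant under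
    \<open>F\<close> and \<open>G\<close>.\<close>
  define Z where "Z = (\<lambda>k. {x\<in>diss. \<forall>j<k. S (G ((F ^^ j) x)) = 0})"
  have subZ: "subspace (Z k)" for k
    using subspace_diss unfolding Z_def subspace_def
    by (auto simp: linear_0 linear_add linear_scale linFk linG linear_S)
  obtain k where k: "\<And>j. dim (Z k) \<le> dim (Z j)"
    using ex_has_least_nat[of "\<lambda>_. True" 0 "\<lambda>k. dim (Z k)"] by auto
  have stable: "Z (Suc k) = Z k"
    by (rule subspace_dim_equal[OF subZ subZ _ k]) (auto simp: Z_def)
  have FZ: "F x \<in> Z k" if "x \<in> Z k" for x
  proof -
    have "x \<in> Z (Suc k)" using that stable by simp
    then have "S (G ((F ^^ Suc j) x)) = 0" if "j < k" for j using that unfolding Z_def by blast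
    then show ?thesis using that FD unfolding Z_def by (auto simp: funpow_swap1)
  qed
  have GZ: "G x \<in> Z k" if "x \<in> Z k" for x
  proof -
    have "G x = (1/2) *\<^sub>R (F x + x)" by (simp add: F_def)
    then show ?thesis using that FZ subZ by (simp add: subspace_add subspace_scale)
  qed
  have "G ` Z k = Z k"
  proof (rule linear_inj_on_subspace_image_eq[OF linG subZ])
    show "x = 0" if "G x = 0" for x using TG[of x] that linear_0[OF linT] by simp
  qed (use GZ in auto)
  \<comment> \<open>Surjectivity of \<open>G\<close> on \<open>Z k\<close> gives z = G w. The first
    step from w loses nothing, so S z = 0, and then w = T z = z - K z shows that K z stays in
    \<open>Z k\<close>.\<close>
  have Zz: "S z = 0 \<and> K z \<in> Z k" if "z \<in> Z k" for z
  proof -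
    have "z \<in> G ` Z k" using that \<open>G ` Z k = Z k\<close> by simp
    then obtain w where w: "w \<in> Z k" "z = G w" by auto
    then have "w \<in> Z (Suc k)" using stable by simp
    then have "S (G ((F ^^ 0) w)) = 0" unfolding Z_def by blast
    then have S: "S z = 0" using w by simp
    have "K z = z - w" using w TG[of w] S by (simp add: T_def gen_def algebra_simps)
    then show ?thesis using S that w subZ by (simp add: subspace_diff)
  qed
  have Z0: "x = 0" if "x \<in> Z k" for x
  proof (rule skew_invariant_trivial[OF subZ[of k] _ _ _ that])
    show "Z k \<subseteq> diss" unfolding Z_def by blast
  qed (use Zz in blast)+
  \<comment> \<open>\<open>Z N = Z k\<close> is trivial, and N is positive, so that the sum
    \<open>p\<close> below contains the definite term for j = 0.\<close>
  define N where "N = Suc k"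
  have strict: "ip ((F ^^ N) x) ((F ^^ N) x) < ip x x" if "x \<in> diss" "x \<noteq> 0" for x
  proof (rule ccontr)
    assume "\<not> ?thesis"
    then have le: "(\<Sum>j<N. 4 * ip (G ((F ^^ j) x)) (S (G ((F ^^ j) x)))) \<le> 0"
      unfolding tele[symmetric] by simp
    have "(\<Sum>j<N. 4 * ip (G ((F ^^ j) x)) (S (G ((F ^^ j) x)))) = 0"
      by (rule antisym[OF le]) (auto intro!: sum_nonneg S_psd)
    then have "\<forall>j<N. ip (G ((F ^^ j) x)) (S (G ((F ^^ j) x))) = 0"
      by (subst (asm) sum_nonneg_eq_0_iff) (auto intro: S_psd)
    then have "x \<in> Z N" using that S_eq_0 unfolding Z_def by auto
    then show False using Z0 that stable by (auto simp: N_def)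
  qed
  define p where "p = (\<lambda>x y. \<Sum>j<N. ip ((F ^^ j) x) ((F ^^ j) y))"
  have bilp: "bilinear p"
    unfolding bilinear_def p_def
    by (intro conjI allI linearI)
      (auto simp: linear_add[OF linFk] linear_scale[OF linFk] ip.add_left ip.add_right
         ip.scaleR_left ip.scaleR_right sum.distrib sum_distrib_left)
  have symp: "p x y = p y x" for x y unfolding p_def by (simp add: ip_sym)
  have posp: "0 < p x x" if "x \<noteq> 0" for x
  proof -
    have "0 < ip ((F ^^ 0) x) ((F ^^ 0) x)" using that ip_pos by simp
    also have "\<dots> \<le> p x x" unfolding p_def
      by (rule member_le_sum) (auto simp: N_def ip_nonneg)
    finally show ?thesis .
  qed
  \<comment> \<open>The sum telescopes, so one step of \<open>F\<close> lowers \<open>p\<close> by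
    what N steps take from \<open>ip\<close>; at \<open>T y\<close> that loss is
    \<open>- 4 * p y (gen y)\<close>.\<close>
  have neg: "0 < - p y (gen y)" if "y \<in> diss" "y \<noteq> 0" for y
  proof -
    have x: "T y \<in> diss" "T y \<noteq> 0" using that \<open>T ` diss = diss\<close> T0 by auto
    have "p (T y) (T y) - p (F (T y)) (F (T y))
        = (\<Sum>j<N. ip ((F ^^ j) (T y)) ((F ^^ j) (T y)) - ip ((F ^^ Suc j) (T y)) ((F ^^ Suc j) (T y)))"
      unfolding p_def by (simp add: sum_subtractf funpow_swap1)
    also have "\<dots> = ip (T y) (T y) - ip ((F ^^ N) (T y)) ((F ^^ N) (T y))"
      by (subst sum_lessThan_telescope') simp
    finally have "0 < p (T y) (T y) - p (F (T y)) (F (T y))" using strict[OF x] by simp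
    moreover have "p (T y) (T y) - p (F (T y)) (F (T y)) = - 4 * p y (gen y)"
      unfolding FT using bilp symp[of "gen y" y]
      by (simp add: T_def bilinear_ladd bilinear_radd bilinear_lsub bilinear_rsub)
    ultimately show ?thesis by simp
  qed
  have "bilinear (\<lambda>x y. - p x (gen y))"
    using bilp unfolding bilinear_def
    by (intro conjI allI linear_compose_neg) (auto intro: linear_compose[OF linear_gen, unfolded o_def])
  from bilinear_pos_coercive[OF this subspace_diss neg]
  obtain c where "c > 0" "\<And>x. x \<in> diss \<Longrightarrow> c * (norm x)\<^sup>2 \<le> - p x (gen x)" by blast
  then show ?thesis using that[OF bilp symp posp, of c] by force
qed

text \<open>A last-exit argument: after the last time spent in the sublevel set of \<open>p\<close>
  at height \<open>L\<close>, the trajectory lies where \<open>p\<close> cannot increase, so it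
  never rises above \<open>L\<close>.\<close>

lemma reachable_set_diss_bounded:
  fixes B :: "'b::euclidean_space \<Rightarrow> 'a"
  assumes f: "\<And>x. x \<in> diss \<Longrightarrow> f x = gen x" and bnd: "bounded (B ` U)"
  shows "bounded (reachable_set diss f B U x0)"
proof -
  obtain p c where bilp: "bilinear p" and symp: "\<And>x y. p x y = p y x" and posp: "\<And>x. x \<noteq> 0 \<Longrightarrow> 0 < p x x"
    and c: "c > 0" "\<And>x. x \<in> diss \<Longrightarrow> p x (gen x) \<le> - c * (norm x)\<^sup>2" using lyapunov_form by blast
  interpret p: bounded_bilinear p using bilp by (simp add: bilinear_conv_bounded_bilinear)
  obtain m where m: "m > 0" "\<And>x. m * (norm x)\<^sup>2 \<le> p x x"
    using bilinear_pos_coercive[OF bilp subspace_UNIV posp] by auto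
  obtain M where M: "M > 0" "\<And>x y. norm (p x y) \<le> norm x * norm y * M"
    using p.pos_bounded by blast
  obtain \<beta> where \<beta>: "\<beta> > 0" "\<And>v. v \<in> U \<Longrightarrow> norm (B v) \<le> \<beta>"
    using bnd unfolding bounded_pos by auto
  \<comment> \<open>From this radius on, the loss \<open>c * (norm x)^2\<close> dominates the input
    term, at most \<open>norm x * \<beta> * M\<close>.\<close>
  define r where "r = \<beta> * M / c"
  have decay: "p x (gen x + B v) \<le> 0" if "x \<in> diss" "v \<in> U" "norm x \<ge> r" for x v
  proof -
    have "p x (B v) \<le> norm x * norm (B v) * M" using M(2)[of x "B v"] by simp
    also have "\<dots> \<le> norm x * \<beta> * M"
      using \<beta>(2)[OF that(2)] M(1) by (intro mult_right_mono mult_left_mono) auto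
    also have "\<dots> \<le> c * (norm x)\<^sup>2"
      using mult_left_mono[OF that(3), of "c * norm x"] c(1) by (simp add: r_def power2_eq_square algebra_simps)
    finally show ?thesis using c(2)[OF that(1)] by (simp add: p.add_right)
  qed
  \<comment> \<open>High enough for the sublevel set to contain both \<open>x0\<close> and the ball
    of radius r.\<close>
  define L where "L = max (p x0 x0) (M * r\<^sup>2)"
  have r0: "r \<ge> 0" unfolding r_def using \<beta> M c by simp
  have reach: "p x1 x1 \<le> L" if "T \<ge> 0" and u: "u \<in> L1_controls T U" and st: "steers diss f B u T x0 x1" for T u x1
  proof (rule ccontr)
    assume "\<not> p x1 x1 \<le> L"
    then have gt: "p x1 x1 > L" by simp
    obtain x where ac: "abs_continuous_on 0 T x" and xD: "\<And>t. t \<in> {0..T} \<Longrightarrow> x t \<in> diss" and "x 0 = x0" "x T = x1"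
      and dx: "AE t in lebesgue. t \<in> {0<..<T} \<longrightarrow> (x has_vector_derivative (f (x t) + B (u t))) (at t)"
      using st unfolding steers_def by auto
    have uU: "u t \<in> U" if "t \<in> {0<..<T}" for t using u that unfolding L1_controls_def by auto
    define g where "g = (\<lambda>t. p (x t) (x t))"
    have contx: "continuous_on {0..T} x" using ac by (rule abs_continuous_on_imp_continuous_on)
    then have contg: "continuous_on {0..T} g" unfolding g_def by (intro p.continuous_on)
    define X where "X = {t \<in> {0..T}. g t \<le> L}"
    have "closed X" unfolding X_def
      using continuous_closed_preimage[OF contg closed_atLeastAtMost, of "{..L}"]
      by (auto simp: vimage_def Int_def)
    moreover have "0 \<in> X" unfolding X_def g_def L_def using \<open>x 0 = x0\<close> \<open>T \<ge> 0\<close> by auto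
    moreover have bdd: "bdd_above X" unfolding X_def by (rule bdd_aboveI[of _ T]) auto
    ultimately have s: "Sup X \<in> X" by (intro closed_contains_Sup) auto
    define s where "s = Sup X"
    have sX: "0 \<le> s" "s \<le> T" "g s \<le> L" using s unfolding s_def X_def by auto
    have above: "g t > L" if "s < t" "t \<le> T" for t
    proof (rule ccontr)
      assume "\<not> g t > L"
      then have "t \<in> X" using that sX by (auto simp: X_def)
      then have "t \<le> s" unfolding s_def using bdd by (rule cSup_upper)
      then show False using that by simp
    qed
    have "g T \<le> g s"
    proof (rule abs_continuous_on_nonincreasing[OF sX(2)])
      \<comment> \<open>The trajectory has compact range, on which the quadratic form is Lipschitz;
        hence \<open>g\<close> is absolutely continuous.\<close>
      have "bounded (x ` {0..T})"
        using contx compact_continuous_image compact_imp_bounded by blast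
      then obtain b where b: "b > 0" "\<And>t. t \<in> {0..T} \<Longrightarrow> norm (x t) \<le> b" unfolding bounded_pos by auto
      have "(2 * b * M)-lipschitz_on (x ` {0..T}) (\<lambda>y. p y y)"
      proof (rule lipschitz_onI)
        fix y z assume "y \<in> x ` {0..T}" "z \<in> x ` {0..T}"
        then have yz: "norm y \<le> b" "norm z \<le> b" using b by auto
        have "p y y - p z z = p (y + z) (y - z)"
          by (simp add: p.add_left p.diff_right symp[of z y])
        then have "dist (p y y) (p z z) \<le> norm (y + z) * norm (y - z) * M"
          using M(2)[of "y + z" "y - z"] by (simp add: dist_real_def)
        also have "\<dots> \<le> (2 * b) * norm (y - z) * M"
          using yz norm_triangle_ineq[of y z] M(1) by (intro mult_right_mono) auto
        finally show "dist (p y y) (p z z) \<le> 2 * b * M * dist y z"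
          by (simp add: dist_norm mult_ac)
      qed (use b M in auto)
      from abs_continuous_on_compose_lipschitz[OF ac this]
      have "abs_continuous_on 0 T g" unfolding g_def .
      then show "abs_continuous_on s T g" by (rule abs_continuous_on_subinterval) (use sX in auto)
      show "AE t in lebesgue. t \<in> {s<..<T} \<longrightarrow> (\<exists>d\<le>0. (g has_real_derivative d) (at t))"
        using dx
      proof (rule AE_mp, intro AE_I2 impI)
        fix t assume imp: "t \<in> {0<..<T} \<longrightarrow> (x has_vector_derivative (f (x t) + B (u t))) (at t)"
          and t: "t \<in> {s<..<T}"
        then have t0: "t \<in> {0<..<T}" using sX by auto
        have xt: "x t \<in> diss" using t0 by (intro xD) auto
        have d: "(x has_vector_derivative (gen (x t) + B (u t))) (at t)"
          using imp t0 f[OF xt] by auto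
        have "(g has_vector_derivative (p (x t) (gen (x t) + B (u t)) + p (gen (x t) + B (u t)) (x t))) (at t)"
          unfolding g_def by (rule p.has_vector_derivative[OF d d])
        then have "(g has_real_derivative (2 * p (x t) (gen (x t) + B (u t)))) (at t)"
          by (simp add: has_real_derivative_iff_has_vector_derivative symp[of _ "x t"])
        moreover have "norm (x t) \<ge> r"
        proof (rule ccontr)
          assume "\<not> norm (x t) \<ge> r"
          then have "norm (x t) * norm (x t) * M \<le> r * r * M"
            using M(1) r0 by (intro mult_right_mono mult_mono) auto
          then have "g t \<le> M * r\<^sup>2" using M(2)[of "x t" "x t"] unfolding g_def
            by (simp add: power2_eq_square mult_ac)
          then show False using above[of t] t unfolding L_def by auto
        qed
        ultimately show "\<exists>d\<le>0. (g has_real_derivative d) (at t)"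
          using decay[OF xt uU[OF t0]] by (metis mult_le_0_iff zero_le_numeral)
      qed
    qed
    then show False using gt sX \<open>x T = x1\<close> unfolding g_def by simp
  qed
  show ?thesis
    unfolding bounded_iff
  proof (intro exI ballI)
    fix x1 assume "x1 \<in> reachable_set diss f B U x0"
    then have "p x1 x1 \<le> L" using reach unfolding reachable_set_def by auto
    then have "(norm x1)\<^sup>2 \<le> L / m" using m(2)[of x1] m(1) by (simp add: field_simps)
    then show "norm x1 \<le> sqrt (L / m)" by (rule real_le_rsqrt)
  qed
qed

end

subsection \<open>The flow on the conservative subspace\<close>

context dissipative_system begin

abbreviation P where "P \<equiv> proj_along cons diss"

definition is_flow :: "(real \<Rightarrow> 'a) \<Rightarrow> bool" where
  "is_flow z \<longleftrightarrow> (\<forall>t. z t \<in> cons \<and> (z has_vector_derivative K (z t)) (at t))"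

lemma is_flow_lincomb:
  assumes y: "is_flow y" and z: "is_flow z"
  shows "is_flow (\<lambda>t. y t + r *\<^sub>R z t)"
  unfolding is_flow_def
proof (intro allI conjI)
  fix t
  show "y t + r *\<^sub>R z t \<in> cons"
    using y z subspace_cons unfolding is_flow_def by (simp add: subspace_add subspace_scale)
  have "(y has_vector_derivative K (y t)) (at t)" "(z has_vector_derivative K (z t)) (at t)"
    using y z unfolding is_flow_def by auto
  then have "((\<lambda>t. y t + r *\<^sub>R z t) has_vector_derivative (K (y t) + r *\<^sub>R K (z t))) (at t)"
    by (intro has_vector_derivative_add bounded_linear.has_vector_derivative[OF bounded_linear_scaleR_right])
  then show "((\<lambda>t. y t + r *\<^sub>R z t) has_vector_derivative K (y t + r *\<^sub>R z t)) (at t)"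
    by (simp add: linear_add[OF linear_K] linear_scale[OF linear_K])
qed

text \<open>Since \<open>K\<close> is semisimple on \<open>cons\<close>, trigonometric functions replace the matrix exponential.\<close>

lemma is_flow_exists:
  assumes "x \<in> cons" shows "\<exists>z. is_flow z \<and> z 0 = x"
  using assms unfolding cons_def
proof (induction rule: span_induct)
  case base
  have zero: "is_flow (\<lambda>_. 0)"
    using subspace_0[OF subspace_cons] by (auto simp: is_flow_def linear_0 linear_K)
  show ?case
    unfolding subspace_def
  proof (intro conjI ballI allI; clarsimp)
    show "\<exists>z. is_flow z \<and> z 0 = 0" using zero by (intro exI[of _ "\<lambda>_. 0"]) simp
  next
    fix y z assume "is_flow y" "is_flow z"
    then show "\<exists>w. is_flow w \<and> w 0 = y 0 + z 0"
      using is_flow_lincomb[of y z 1] by (intro exI[of _ "\<lambda>t. y t + z t"]) simp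
  next
    fix r z assume "is_flow z"
    then show "\<exists>w. is_flow w \<and> w 0 = r *\<^sub>R z 0"
      using is_flow_lincomb[OF zero, of z r] by (intro exI[of _ "\<lambda>t. r *\<^sub>R z t"]) simp
  qed
next
  case (step a)
  then obtain b \<alpha> where *: "K a = - (\<alpha> *\<^sub>R b)" "K b = \<alpha> *\<^sub>R a" "S a = 0" "S b = 0" by auto
  then have ab: "a \<in> cons" "b \<in> cons" by (rule cons_I, rule cons_I2)
  define z where "z = (\<lambda>t. cos (\<alpha> * t) *\<^sub>R a - sin (\<alpha> * t) *\<^sub>R b)"
  have "(z has_vector_derivative ((- \<alpha> * sin (\<alpha> * t)) *\<^sub>R a - (\<alpha> * cos (\<alpha> * t)) *\<^sub>R b)) (at t)" for t
  proof -
    have "((\<lambda>t. cos (\<alpha> * t)) has_real_derivative (- \<alpha> * sin (\<alpha> * t))) (at t)"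
      "((\<lambda>t. sin (\<alpha> * t)) has_real_derivative (\<alpha> * cos (\<alpha> * t))) (at t)"
      by (auto intro!: derivative_eq_intros)
    from this[THEN has_vector_derivative_scaleR[OF _ has_vector_derivative_const]]
    show ?thesis unfolding z_def by (auto intro!: has_vector_derivative_diff)
  qed
  moreover have "K (z t) = (- \<alpha> * sin (\<alpha> * t)) *\<^sub>R a - (\<alpha> * cos (\<alpha> * t)) *\<^sub>R b" for t
    by (simp add: z_def linear_diff[OF linear_K] linear_scale[OF linear_K] * mult.commute)
  moreover have "z t \<in> cons" for t
    unfolding z_def using ab subspace_cons by (simp add: subspace_diff subspace_scale)
  ultimately have "is_flow z" by (simp add: is_flow_def)
  moreover have "z 0 = a" by (simp add: z_def)
  ultimately show ?case by blast
qed

text \<open>The two terms of the product rule cancel by skewness. Uniqueness and isometry of the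
  flow both rest on this.\<close>

lemma is_flow_ip:
  assumes "is_flow y" "is_flow z"
  shows "ip (y t) (z t) = ip (y 0) (z 0)"
proof -
  have "((\<lambda>t. ip (y t) (z t)) has_vector_derivative (ip (y t) (K (z t)) + ip (K (y t)) (z t))) (at t)" for t
    using assms unfolding is_flow_def by (intro ip.has_vector_derivative) auto
  then have "((\<lambda>t. ip (y t) (z t)) has_real_derivative 0) (at t)" for t
    by (simp add: has_real_derivative_iff_has_vector_derivative K_skew)
  then show ?thesis by (intro DERIV_isconst_all) auto
qed

lemma is_flow_unique:
  assumes "is_flow y" "is_flow z" "y 0 = z 0"
  shows "y t = z t"
proof -
  have "is_flow (\<lambda>t. y t + (-1) *\<^sub>R z t)" using assms by (intro is_flow_lincomb)
  from is_flow_ip[OF this this, of t] have "ip (y t - z t) (y t - z t) = 0"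
    using assms(3) by (simp add: ip.zero_left)
  then show ?thesis by (simp add: ip_self_eq_0)
qed

text \<open>This is the exponential of t K composed with \<open>P\<close>. Including
  \<open>P\<close> makes it linear on the whole space and lets
  \<open>flow t (flow (- t) w) = P w\<close> produce the projected input operator.\<close>

definition flow :: "real \<Rightarrow> 'a \<Rightarrow> 'a" where
  "flow t x = (SOME z. is_flow z \<and> z 0 = P x) t"

lemma flow_is_flow: "is_flow (\<lambda>t. flow t x)" and flow_0: "flow 0 x = P x"
  using someI_ex[OF is_flow_exists[OF proj_cons_in[of x]]] unfolding flow_def by auto

lemma flow_eqI: "is_flow z \<Longrightarrow> z 0 = P x \<Longrightarrow> flow t x = z t"
  by (rule is_flow_unique[OF flow_is_flow]) (auto simp: flow_0)

lemma flow_in_cons: "flow t x \<in> cons"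
  using flow_is_flow[of x] unfolding is_flow_def by simp

lemma flow_has_vector_derivative: "((\<lambda>t. flow t x) has_vector_derivative K (flow t x)) (at t within X)"
  using flow_is_flow[of x] unfolding is_flow_def by (simp add: has_vector_derivative_at_within)

lemma linear_flow: "linear (flow t)"
proof (rule linearI)
  fix x y r
  show "flow t (x + y) = flow t x + flow t y"
    using is_flow_lincomb[OF flow_is_flow flow_is_flow, of x 1 y]
    by (intro flow_eqI) (auto simp: flow_0 linear_add linear_proj_cons)
  have "is_flow (\<lambda>t. flow t 0 + r *\<^sub>R flow t x)" by (intro is_flow_lincomb flow_is_flow)
  moreover have "flow t 0 = 0" for t
    using subspace_0[OF subspace_cons]
    by (intro flow_eqI) (auto simp: linear_0 linear_proj_cons is_flow_def linear_K)
  ultimately show "flow t (r *\<^sub>R x) = r *\<^sub>R flow t x"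
    by (intro flow_eqI) (auto simp: flow_0 linear_scale linear_proj_cons)
qed

lemma ip_flow: "ip (flow t x) (flow t y) = ip (P x) (P y)"
  using is_flow_ip[OF flow_is_flow flow_is_flow] by (simp add: flow_0)

lemma flow_flow: "flow s (flow t x) = flow (s + t) x"
proof (rule flow_eqI)
  show "is_flow (\<lambda>s. flow (s + t) x)"
    unfolding is_flow_def
  proof (intro allI conjI flow_in_cons)
    fix s
    have "((\<lambda>s. flow s x) \<circ> (\<lambda>s. s + t) has_vector_derivative 1 *\<^sub>R K (flow (s + t) x)) (at s)"
      by (rule vector_diff_chain_at) (auto intro!: derivative_eq_intros flow_has_vector_derivative)
    then show "((\<lambda>s. flow (s + t) x) has_vector_derivative K (flow (s + t) x)) (at s)"
      by (simp add: o_def)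
  qed
  show "flow (0 + t) x = P (flow t x)" by (simp add: proj_cons_id flow_in_cons)
qed

lemma flow_minus: "x \<in> cons \<Longrightarrow> flow t (flow (- t) x) = x" "x \<in> cons \<Longrightarrow> flow (- t) (flow t x) = x"
  by (simp_all add: flow_flow flow_0 proj_cons_id)

text \<open>The adjoint of an isometric flow is the backward flow; \<open>P\<close> is self-adjoint
  for \<open>ip\<close>, which takes care of arguments outside \<open>cons\<close>.\<close>

lemma ip_flow_minus: "ip (flow (- t) v) y = ip v (flow t y)"
proof -
  have "ip (flow (- t) v) y = ip (flow (- t) v) (P y)"
    using ip_proj_cons[OF flow_in_cons, of y "-t" v] by (simp add: ip_sym)
  also have "\<dots> = ip (flow (- t) v) (flow (- t) (flow t y))" by (simp add: flow_flow flow_0)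
  also have "\<dots> = ip (P v) (P (flow t y))" by (rule ip_flow)
  also have "\<dots> = ip v (flow t y)" by (simp add: proj_cons_id flow_in_cons ip_proj_cons)
  finally show ?thesis .
qed

text \<open>Separates the dependence on t from that on v, so joint continuity and the product rule
  reduce to scalar coefficients.\<close>

lemma flow_Basis_sum: "flow t v = (\<Sum>b\<in>Basis. (v \<bullet> b) *\<^sub>R flow t b)"
proof -
  have "flow t v = flow t (\<Sum>b\<in>Basis. (v \<bullet> b) *\<^sub>R b)" by (simp add: euclidean_representation)
  then show ?thesis by (simp add: linear_sum[OF linear_flow] linear_scale[OF linear_flow])
qed

lemma continuous_on_flow_fixed: "continuous_on X (\<lambda>t. flow t x)"
  unfolding continuous_on_eq_continuous_within
  using has_vector_derivative_continuous[OF flow_has_vector_derivative] by blast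

lemma continuous_on_flow:
  assumes "continuous_on X \<tau>" "continuous_on X v"
  shows "continuous_on X (\<lambda>s. flow (\<tau> s) (v s))"
proof -
  have "continuous_on X (\<lambda>s. \<Sum>b\<in>Basis. (v s \<bullet> b) *\<^sub>R flow (\<tau> s) b)"
    by (intro continuous_intros assms continuous_on_compose2[OF continuous_on_flow_fixed[of UNIV]]) auto
  then show ?thesis by (simp add: flow_Basis_sum[symmetric])
qed

lemma flow_has_vector_derivative_product:
  assumes "(v has_vector_derivative v') (at t within X)"
  shows "((\<lambda>t. flow t (v t)) has_vector_derivative (K (flow t (v t)) + flow t v')) (at t within X)"
proof -
  have comp: "((\<lambda>t. v t \<bullet> b) has_real_derivative (v' \<bullet> b)) (at t within X)" for b
    using bounded_linear.has_vector_derivative[OF bounded_linear_inner_left assms]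
    by (simp add: has_real_derivative_iff_has_vector_derivative)
  have "((\<lambda>t. \<Sum>b\<in>Basis. (v t \<bullet> b) *\<^sub>R flow t b) has_vector_derivative
      (\<Sum>b\<in>Basis. (v t \<bullet> b) *\<^sub>R K (flow t b) + (v' \<bullet> b) *\<^sub>R flow t b)) (at t within X)"
    by (intro has_vector_derivative_sum has_vector_derivative_scaleR comp flow_has_vector_derivative)
  moreover have "(\<Sum>b\<in>Basis. (v t \<bullet> b) *\<^sub>R K (flow t b) + (v' \<bullet> b) *\<^sub>R flow t b) = K (flow t (v t)) + flow t v'"
    by (simp add: flow_Basis_sum[of _ "v t"] flow_Basis_sum[of _ v'] sum.distrib
        linear_sum[OF linear_K] linear_scale[OF linear_K])
  ultimately show ?thesis by (simp add: flow_Basis_sum[symmetric])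
qed

lemma flow_bounded: obtains M where "M > 0" "\<And>t x. norm (flow t x) \<le> M * norm x"
proof -
  obtain m where m: "m > 0" "\<And>x. m * (norm x)\<^sup>2 \<le> ip x x"
    using bilinear_pos_coercive[OF bil subspace_UNIV] ip_pos by auto
  obtain M where M: "M > 0" "\<And>x y. norm (ip x y) \<le> norm x * norm y * M"
    using ip.pos_bounded by blast
  obtain L where L: "L > 0" "\<And>x. norm (P x) \<le> L * norm x"
    using linear_bounded_pos[OF linear_proj_cons] by blast
  show ?thesis
  proof (rule that[of "sqrt (M / m) * L"])
    fix t x
    have "m * (norm (flow t x))\<^sup>2 \<le> ip (P x) (P x)" using m(2)[of "flow t x"] by (simp add: ip_flow)
    also have "\<dots> \<le> M * (norm (P x))\<^sup>2" using M(2)[of "P x" "P x"] by (simp add: power2_eq_square mult_ac)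
    finally have "(norm (flow t x))\<^sup>2 \<le> (M / m) * (norm (P x))\<^sup>2" using m(1) by (simp add: field_simps)
    then have "norm (flow t x) \<le> sqrt (M / m * (norm (P x))\<^sup>2)" by (rule real_le_rsqrt)
    also have "\<dots> = sqrt (M / m) * norm (P x)" by (simp add: real_sqrt_mult real_sqrt_divide)
    also have "\<dots> \<le> sqrt (M / m) * (L * norm x)" using L M m by (intro mult_left_mono) auto
    finally show "norm (flow t x) \<le> sqrt (M / m) * L * norm x" by simp
  qed (use M m L in auto)
qed

end

subsection \<open>Steering with small controls\<close>

lemma continuous_vector_derivative_imp_abs_continuous_on:
  fixes x :: "real \<Rightarrow> 'a::real_normed_vector"
  assumes deriv: "\<And>t. t \<in> {a..b} \<Longrightarrow> (x has_vector_derivative x' t) (at t within {a..b})"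
    and cont: "continuous_on {a..b} x'"
  shows "abs_continuous_on a b x"
proof -
  obtain L where L: "L > 0" "\<And>t. t \<in> {a..b} \<Longrightarrow> norm (x' t) \<le> L"
    using compact_imp_bounded[OF compact_continuous_image[OF cont compact_Icc]] unfolding bounded_pos by auto
  have "L-lipschitz_on {a..b} x"
  proof (rule bounded_derivative_imp_lipschitz)
    fix t assume t: "t \<in> {a..b}"
    show "(x has_derivative (\<lambda>h. h *\<^sub>R x' t)) (at t within {a..b})"
      using deriv[OF t] by (simp add: has_vector_derivative_def)
    show "onorm (\<lambda>h. h *\<^sub>R x' t) \<le> L"
      by (rule onorm_le) (use L(2)[OF t] in \<open>simp add: mult.commute[of L] mult_left_mono\<close>)
  qed (use L in auto)
  then show ?thesis by (rule lipschitz_on_imp_abs_continuous_on)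
qed

text \<open>\<open>B'\<close> is the adjoint of \<open>B\<close> between the Euclidean product on
  inputs and \<open>ip\<close>; the last assumption is the Kalman condition on \<open>cons\<close>
  in its dual form.\<close>

locale observed_system = dissipative_system ip K S
  for ip :: "'a::euclidean_space \<Rightarrow> 'a \<Rightarrow> real" and K S :: "'a \<Rightarrow> 'a" +
  fixes B :: "'b::euclidean_space \<Rightarrow> 'a" and B' :: "'a \<Rightarrow> 'b"
  assumes linear_B: "linear B" and linear_B': "linear B'"
    and adjoint_B: "ip (B v) y = v \<bullet> B' y"
    and observable: "x \<in> cons \<Longrightarrow> (\<And>k. B' ((K ^^ k) x) = 0) \<Longrightarrow> x = 0"
begin

lemma continuous_on_B'_flow: "continuous_on X (\<lambda>s. B' (flow s x))"
proof -
  have "bounded_linear B'" using linear_B' by (simp add: linear_conv_bounded_linear)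
  from bounded_linear.continuous_on[OF this continuous_on_flow_fixed] show ?thesis .
qed

lemma continuous_on_gramian: "continuous_on X (\<lambda>s. flow (- s) (B (B' (flow s x))))"
proof -
  have "bounded_linear B" using linear_B by (simp add: linear_conv_bounded_linear)
  from bounded_linear.continuous_on[OF this continuous_on_B'_flow]
  show ?thesis by (rule continuous_on_flow[rotated]) (intro continuous_intros)
qed

text \<open>The controllability Gramian pulled back to time 0; as \<open>K\<close> is skew, the
  adjoint of the backward flow is the forward flow next to \<open>x\<close>.\<close>

definition gramian where "gramian T x = integral {0..T} (\<lambda>s. flow (- s) (B (B' (flow s x))))"

lemma integrable_gramian: "(\<lambda>s. flow (- s) (B (B' (flow s x)))) integrable_on {a..b}"
  by (intro integrable_continuous_real continuous_on_gramian)

lemma linear_gramian: "linear (gramian T)"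
proof (rule linearI)
  fix x y r
  show "gramian T (x + y) = gramian T x + gramian T y"
    unfolding gramian_def
    by (simp add: linear_add[OF linear_flow] linear_add[OF linear_B] linear_add[OF linear_B']
        integral_add integrable_gramian)
  show "gramian T (r *\<^sub>R x) = r *\<^sub>R gramian T x"
    unfolding gramian_def
    by (simp add: linear_scale[OF linear_flow] linear_scale[OF linear_B] linear_scale[OF linear_B'])
qed

lemma gramian_in_cons: "gramian T x \<in> cons"
proof -
  have "bounded_linear P" using linear_proj_cons by (simp add: linear_conv_bounded_linear)
  from integral_linear[OF integrable_gramian this, of 0 T x]
  have "P (gramian T x) = gramian T x" unfolding gramian_def by (simp add: o_def proj_cons_id flow_in_cons)
  then show ?thesis using proj_cons_in[of "gramian T x"] by simp
qed

lemma ip_gramian: "ip (gramian T x) y = integral {0..T} (\<lambda>s. B' (flow s x) \<bullet> B' (flow s y))"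
  using integral_linear[OF integrable_gramian ip.bounded_linear_left[of y], of 0 T x] unfolding gramian_def
  by (simp add: o_def ip_flow_minus adjoint_B)

text \<open>If the output \<open>B' (flow s x)\<close> vanishes on an interval, then so do all its derivatives
  \<open>B' (K\<^sup>k (flow s x))\<close>.\<close>

lemma ip_gramian_pos:
  assumes "x \<in> cons" "x \<noteq> 0"
  shows "0 < ip (gramian 1 x) x"
proof (rule ccontr)
  assume neg: "\<not> ?thesis"
  let ?f = "\<lambda>s. B' (flow s x) \<bullet> B' (flow s x)"
  have cont: "continuous_on {0..1} ?f" by (intro continuous_on_inner continuous_on_B'_flow)
  have "0 \<le> integral {0..1} ?f" by (intro integral_nonneg integrable_continuous_real cont) auto
  then have "integral {0..1} ?f = 0" using neg by (simp add: ip_gramian)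
  then have "(?f has_integral 0) (cbox 0 1)"
    using integrable_integral[OF integrable_continuous_real[OF cont]] by simp
  then have zero: "B' (flow s x) = 0" if "s \<in> {0..1}" for s
    using has_integral_0_cbox_imp_0[of 0 1 ?f s] cont that by auto
  have Kpow: "bounded_linear (\<lambda>y. B' ((K ^^ k) y))" for k
  proof -
    have "linear (K ^^ k)"
    proof (induction k)
      case 0 show ?case by (simp add: id_def linear_ident)
    next
      case (Suc k) show ?case using linear_compose[OF Suc linear_K] by (simp add: o_def)
    qed
    from linear_compose[OF this linear_B'] show ?thesis
      by (simp add: linear_conv_bounded_linear o_def)
  qed
  have vanish: "\<forall>s\<in>{0<..<1}. B' ((K ^^ k) (flow s x)) = 0" for k
  proof (induction k)
    case 0 show ?case using zero by auto
  next
    case (Suc k)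
    show ?case
    proof
      fix s :: real assume s: "s \<in> {0<..<1}"
      have "((\<lambda>s. B' ((K ^^ k) (flow s x))) has_vector_derivative B' ((K ^^ k) (K (flow s x)))) (at s)"
        by (rule bounded_linear.has_vector_derivative[OF Kpow flow_has_vector_derivative])
      moreover have "((\<lambda>s. B' ((K ^^ k) (flow s x))) has_vector_derivative 0) (at s)"
        by (rule has_vector_derivative_transform_within_open[OF has_vector_derivative_const, where S="{0<..<1}"])
           (use Suc s in auto)
      ultimately have "B' ((K ^^ k) (K (flow s x))) = 0" by (rule vector_derivative_unique_at)
      then show "B' ((K ^^ Suc k) (flow s x)) = 0" by (simp add: funpow_swap1)
    qed
  qed
  \<comment> \<open>The derivatives are known to vanish only on the open interval, so observability
    is applied at an interior time and the state is carried back.\<close>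
  have "flow (1/2) x = 0"
    by (rule observable[OF flow_in_cons]) (use vanish in auto)
  then have "flow (- (1/2)) (flow (1/2) x) = 0" by (simp add: linear_0[OF linear_flow])
  then show False using assms by (simp only: flow_minus)
qed

lemma gramian_coercive:
  obtains c where "c > 0" "\<And>(N::nat) x. x \<in> cons \<Longrightarrow> c * N * (norm x)\<^sup>2 \<le> ip (gramian N x) x"
proof -
  have "bilinear (\<lambda>x y. ip (gramian 1 x) y)"
    unfolding bilinear_def
    by (intro conjI allI linearI)
       (auto simp: ip.add_left ip.add_right ip.scaleR_left ip.scaleR_right linear_add[OF linear_gramian] linear_scale[OF linear_gramian])
  from bilinear_pos_coercive[OF this subspace_cons ip_gramian_pos]
  obtain c1 where c1: "c1 > 0" "\<And>x. x \<in> cons \<Longrightarrow> c1 * (norm x)\<^sup>2 \<le> ip (gramian 1 x) x" by blast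
  obtain m where m: "m > 0" "\<And>x. m * (norm x)\<^sup>2 \<le> ip x x"
    using bilinear_pos_coercive[OF bil subspace_UNIV] ip_pos by auto
  obtain M where M: "M > 0" "\<And>x y. norm (ip x y) \<le> norm x * norm y * M"
    using ip.pos_bounded by blast
  have step: "c1 / M * ip x x \<le> ip (gramian 1 x) x" if "x \<in> cons" for x
  proof -
    have "ip x x \<le> M * (norm x)\<^sup>2" using M(2)[of x x] by (simp add: power2_eq_square mult_ac)
    then have "c1 / M * ip x x \<le> c1 / M * (M * (norm x)\<^sup>2)" using c1 M by (intro mult_left_mono) auto
    also have "\<dots> = c1 * (norm x)\<^sup>2" using M by simp
    finally show ?thesis using c1(2)[OF that] by simp
  qed
  \<comment> \<open>The induction runs with \<open>ip x x\<close>, which the flow preserves exactly,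
    unlike the norm: each further unit interval contributes the unit Gramian at
    \<open>flow N x\<close>.\<close>
  have ind: "c1 / M * real N * ip x x \<le> ip (gramian (real N) x) x" if x: "x \<in> cons" for x and N :: nat
  proof (induction N)
    case 0 show ?case by (simp add: ip_gramian)
  next
    case (Suc N)
    let ?f = "\<lambda>s. B' (flow s x) \<bullet> B' (flow s x)"
    have cont: "continuous_on X ?f" for X by (intro continuous_on_inner continuous_on_B'_flow)
    have "ip (gramian (real (Suc N)) x) x = integral {0..real N} ?f + integral {real N..real (Suc N)} ?f"
      unfolding ip_gramian
      by (rule Henstock_Kurzweil_Integration.integral_combine[symmetric]) (auto intro: integrable_continuous_real cont)
    also have "integral {real N..real (Suc N)} ?f = integral {0..1} (\<lambda>s. ?f (s + real N))"
      using integral_shift[OF cont, of 0 1 "real N"] by (simp add: o_def add.commute)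
    also have "\<dots> = ip (gramian 1 (flow (real N) x)) (flow (real N) x)" by (simp add: ip_gramian flow_flow)
    finally have eq: "ip (gramian (real (Suc N)) x) x = ip (gramian (real N) x) x + ip (gramian 1 (flow (real N) x)) (flow (real N) x)"
      by (simp add: ip_gramian)
    have "c1 / M * ip x x \<le> ip (gramian 1 (flow (real N) x)) (flow (real N) x)"
      using step[OF flow_in_cons[of "real N" x]] x by (simp add: ip_flow proj_cons_id)
    with Suc eq show ?case by (simp add: distrib_left distrib_right)
  qed
  show ?thesis
  proof (rule that[of "c1 / M * m"])
    fix N :: nat and x assume x: "x \<in> cons"
    have "c1 / M * m * N * (norm x)\<^sup>2 = c1 / M * N * (m * (norm x)\<^sup>2)" by simp
    also have "\<dots> \<le> c1 / M * N * ip x x" using c1 M m(2) by (intro mult_left_mono) auto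
    also have "\<dots> \<le> ip (gramian N x) x" by (rule ind[OF x])
    finally show "c1 / M * m * N * (norm x)\<^sup>2 \<le> ip (gramian N x) x" .
  qed (use c1 M m in auto)
qed

text \<open>Variation of constants: in the moving frame the state is \<open>v\<close>, whose
  derivative is the Gramian integrand, and the equation for \<zeta> says that \<open>v\<close> ends
  at \<open>flow (- T) x1\<close>.\<close>

lemma steers_gramian:
  assumes f: "\<And>x. x \<in> cons \<Longrightarrow> f x = K x" and T: "T \<ge> 0" and x: "x0 \<in> cons" "x1 \<in> cons"
    and \<zeta>: "gramian T \<zeta> = flow (- T) x1 - x0"
  shows "steers cons f (\<lambda>v. P (B v)) (\<lambda>t. B' (flow t \<zeta>)) T x0 x1"
proof -
  define h where "h = (\<lambda>s. flow (- s) (B (B' (flow s \<zeta>))))"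
  define v where "v = (\<lambda>t. x0 + integral {0..t} h)"
  define x where "x = (\<lambda>t. flow t (v t))"
  have conth: "continuous_on X h" for X unfolding h_def by (rule continuous_on_gramian)
  have dx: "(x has_vector_derivative (K (x t) + P (B (B' (flow t \<zeta>))))) (at t within {0..T})"
    if t: "t \<in> {0..T}" for t
  proof -
    have "(v has_vector_derivative h t) (at t within {0..T})"
      using has_vector_derivative_add[OF has_vector_derivative_const integral_has_vector_derivative[OF conth t], of x0]
      unfolding v_def by simp
    from flow_has_vector_derivative_product[OF this] show ?thesis
      unfolding x_def h_def by (simp add: flow_flow flow_0)
  qed
  have contv: "continuous_on {0..T} x"
    using has_vector_derivative_continuous[OF dx] by (auto simp: continuous_on_eq_continuous_within)
  have "continuous_on {0..T} (\<lambda>t. K (x t) + P (B (B' (flow t \<zeta>))))"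
    using linear_K linear_B linear_proj_cons
    by (intro continuous_on_add bounded_linear.continuous_on[of K] contv bounded_linear.continuous_on[of P]
          bounded_linear.continuous_on[of B] continuous_on_B'_flow)
       (auto simp: linear_conv_bounded_linear)
  with dx have ac: "abs_continuous_on 0 T x"
    by (rule continuous_vector_derivative_imp_abs_continuous_on)
  show ?thesis
    unfolding steers_def
  proof (intro exI[of _ x] conjI ballI ac AE_I2 impI)
    show "x t \<in> cons" for t unfolding x_def by (rule flow_in_cons)
    show "x 0 = x0" by (simp add: x_def v_def flow_0 proj_cons_id x)
    have "v T = flow (- T) x1" using \<zeta> by (simp add: v_def h_def gramian_def)
    then show "x T = x1" unfolding x_def by (simp only: flow_minus x)
    fix t assume t: "t \<in> {0<..<T}"
    then have "at t within {0..T} = at t" by (intro at_within_Icc_at) auto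
    then show "(x has_vector_derivative f (x t) + P (B (B' (flow t \<zeta>)))) (at t)"
      using dx[of t] t f[of "x t"] flow_in_cons by (simp add: x_def)
  qed
qed

lemma steer_cons:
  assumes f: "\<And>x. x \<in> cons \<Longrightarrow> f x = K x" and U: "0 \<in> interior U" and x: "x0 \<in> cons" "x1 \<in> cons"
  shows "\<exists>T>0. \<exists>u\<in>L1_controls T U. steers cons f (\<lambda>v. P (B v)) u T x0 x1"
proof -
  obtain \<epsilon> where \<epsilon>: "\<epsilon> > 0" "ball 0 \<epsilon> \<subseteq> U" using U unfolding mem_interior by blast
  obtain c where c: "c > 0" "\<And>(N::nat) x. x \<in> cons \<Longrightarrow> c * N * (norm x)\<^sup>2 \<le> ip (gramian N x) x"
    using gramian_coercive by blast
  obtain M where M: "M > 0" "\<And>x y. norm (ip x y) \<le> norm x * norm y * M"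
    using ip.pos_bounded by blast
  obtain Me where Me: "Me > 0" "\<And>t x. norm (flow t x) \<le> Me * norm x" using flow_bounded by blast
  obtain Mb where Mb: "Mb > 0" "\<And>x. norm (B' x) \<le> Mb * norm x"
    using linear_bounded_pos[OF linear_B'] by blast
  \<comment> \<open>Bounds the displacement \<open>d\<close> for every horizon, so \<open>N\<close>
    may be chosen afterwards.\<close>
  define \<delta> where "\<delta> = Me * norm x1 + norm x0"
  \<comment> \<open>Coercivity will give \<open>c * N * norm \<zeta> <= \<delta> * M\<close>, and
    the control is at most \<open>Mb * Me * norm \<zeta>\<close>; this choice pushes it below
    \<epsilon>.\<close>
  obtain n :: nat where n: "Mb * Me * (\<delta> * M) / (c * \<epsilon>) < n" using reals_Archimedean2 by blast
  define N where "N = Suc n"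
  have N: "Mb * Me * (\<delta> * M) < c * N * \<epsilon>" "N > 0"
    using n c \<epsilon> by (auto simp: N_def divide_less_eq algebra_simps intro: add_strict_increasing)
  define d where "d = flow (- real N) x1 - x0"
  have dC: "d \<in> cons" unfolding d_def using x flow_in_cons subspace_cons by (simp add: subspace_diff)
  have dn: "norm d \<le> \<delta>"
    unfolding d_def \<delta>_def using norm_triangle_ineq4[of "flow (- real N) x1" x0] Me(2)[of "- real N" x1] by simp
  have "gramian N ` cons = cons"
  proof (rule linear_inj_on_subspace_image_eq[OF linear_gramian subspace_cons])
    show "z = 0" if "z \<in> cons" "gramian N z = 0" for z
      using c(2)[OF that(1), of N] that(2) c(1) N(2) by (auto simp: ip.zero_left mult_le_0_iff)
  qed (use gramian_in_cons in auto)
  then have "d \<in> gramian N ` cons" using dC by simp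
  then obtain \<zeta> where \<zeta>: "\<zeta> \<in> cons" "gramian N \<zeta> = d" by auto
  have "c * N * (norm \<zeta>)\<^sup>2 \<le> ip d \<zeta>" using c(2)[OF \<zeta>(1), of N] \<zeta>(2) by simp
  also have "\<dots> \<le> norm d * norm \<zeta> * M" using M(2)[of d \<zeta>] by simp
  also have "\<dots> \<le> \<delta> * norm \<zeta> * M" using dn M by (intro mult_right_mono) auto
  finally have le: "c * N * (norm \<zeta>)\<^sup>2 \<le> \<delta> * norm \<zeta> * M" .
  have \<zeta>n: "c * N * norm \<zeta> \<le> \<delta> * M"
  proof (cases "\<zeta> = 0")
    case True
    have "0 \<le> \<delta>" using dn norm_ge_zero[of d] by linarith
    then show ?thesis using True M by simp
  next
    case False
    have "(c * N * norm \<zeta>) * norm \<zeta> \<le> (\<delta> * M) * norm \<zeta>"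
      using le by (simp add: power2_eq_square mult_ac)
    then show ?thesis using False by simp
  qed
  define u where "u = (\<lambda>t. B' (flow t \<zeta>))"
  have small: "u t \<in> U" for t
  proof -
    have "norm (u t) \<le> Mb * (Me * norm \<zeta>)"
      unfolding u_def using Mb(2)[of "flow t \<zeta>"] mult_left_mono[OF Me(2)[of t \<zeta>], of Mb] Mb(1) by linarith
    then have "c * N * norm (u t) \<le> c * N * (Mb * (Me * norm \<zeta>))" using c by (intro mult_left_mono) auto
    also have "\<dots> = Mb * Me * (c * N * norm \<zeta>)" by simp
    also have "\<dots> \<le> Mb * Me * (\<delta> * M)" using \<zeta>n Mb Me by (intro mult_left_mono) auto
    also have "\<dots> < c * N * \<epsilon>" by (rule N)
    finally have "norm (u t) < \<epsilon>" using c N(2) by simp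
    then show ?thesis using \<epsilon>(2) by auto
  qed
  have "u absolutely_integrable_on {0..real N}"
    unfolding u_def by (intro absolutely_integrable_continuous_real continuous_on_B'_flow)
  then have "set_integrable lebesgue {0<..<real N} u"
    by (rule set_integrable_subset) auto
  then have "u \<in> L1_controls (real N) U" using small unfolding L1_controls_def by simp
  moreover have "steers cons f (\<lambda>v. P (B v)) u (real N) x0 x1"
    unfolding u_def using f x \<zeta>(2) by (intro steers_gramian) (auto simp: d_def)
  ultimately show ?thesis using N(2) by (intro exI[of _ "real N"]) auto
qed

end

subsection \<open>Port-Hamiltonian systems\<close>

context dissipative_system begin

text \<open>A purely imaginary mode conserves energy: the cross terms in
  \<open>ip a (gen a) + ip b (gen b)\<close> cancel, so neither part dissipates.\<close>

lemma imaginary_eigenpair_S: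
  assumes "gen a = - (\<alpha> *\<^sub>R b)" "gen b = \<alpha> *\<^sub>R a"
  shows "S a = 0" "S b = 0"
proof -
  have "ip a (S a) + ip b (S b) = 0"
    using ip_gen_self[of a] ip_gen_self[of b] ip_sym[of a b]
    by (simp add: assms ip.minus_right ip.scaleR_right)
  then have "ip a (S a) = 0" "ip b (S b) = 0" using S_psd[of a] S_psd[of b] by auto
  then show "S a = 0" "S b = 0" by (auto intro: S_eq_0)
qed

end

section \<open>Translation between matrices and the abstract setting\<close>

lemma matrix_vector_inner: "(M *v x) \<bullet> y = x \<bullet> (transpose M *v y)" for M :: "real^'n^'m"
  by (metis dot_lmul_matrix transpose_matrix_vector transpose_transpose)

lemma matrix_vector_mult_minus_left: "(- M) *v x = - (M *v x)" for M :: "'a::ring_1^'n^'m"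
  using matrix_vector_mult_diff_rdistrib[of 0 M x] by simp

lemma matrix_vector_mult_minus_right: "M *v (- x) = - (M *v x)" for M :: "'a::ring_1^'n^'m"
  using matrix_vector_mult_diff_distrib[of M 0 x] by simp

lemma transpose_diff: "transpose (M - N) = transpose M - transpose N" for M :: "'a::ab_group_add^'n^'m"
  by (simp add: transpose_def vec_eq_iff)

lemma port_hamiltonian_dissipative_system:
  fixes J R Q :: "real^'n^'n"
  assumes J_skew: "transpose J = - J"
    and R_sym: "transpose R = R" and R_psd: "\<And>x. 0 \<le> x \<bullet> (R *v x)"
    and Q_sym: "transpose Q = Q" and Q_pd: "\<And>x. x \<noteq> 0 \<Longrightarrow> 0 < x \<bullet> (Q *v x)"
  shows "dissipative_system (\<lambda>x y. (Q *v x) \<bullet> y) ((*v) (J ** Q)) ((*v) (R ** Q))"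
proof
  show "bilinear (\<lambda>x y. (Q *v x) \<bullet> y)"
    unfolding bilinear_def
    by (intro conjI allI linearI) (auto simp: matrix_vector_right_distrib inner_add matrix_vector_mult_scaleR)
next
  fix x y :: "real^'n"
  show "(Q *v x) \<bullet> y = (Q *v y) \<bullet> x"
    using matrix_vector_inner[of Q x y] Q_sym by (simp add: inner_commute)
  show "(Q *v x) \<bullet> x > 0" if "x \<noteq> 0" using Q_pd[OF that] by (simp add: inner_commute)
  have Q: "(Q *v u) \<bullet> v = u \<bullet> (Q *v v)" for u v using matrix_vector_inner[of Q u v] Q_sym by simp
  have J: "(J *v u) \<bullet> v = - (u \<bullet> (J *v v))" for u v
    using matrix_vector_inner[of J u v] J_skew by (simp add: matrix_vector_mult_minus_left del: transpose_matrix_vector)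
  have R: "(R *v u) \<bullet> v = u \<bullet> (R *v v)" for u v
    using matrix_vector_inner[of R u v] R_sym by simp
  show "(Q *v ((J ** Q) *v x)) \<bullet> y = - ((Q *v x) \<bullet> ((J ** Q) *v y))"
    by (simp add: matrix_vector_mul_assoc[symmetric] Q[of "J *v _"] J)
  show "(Q *v ((R ** Q) *v x)) \<bullet> y = (Q *v x) \<bullet> ((R ** Q) *v y)"
    by (simp add: matrix_vector_mul_assoc[symmetric] Q[of "R *v _"] R)
  show "0 \<le> (Q *v x) \<bullet> ((R ** Q) *v x)"
    using R_psd[of "Q *v x"] by (simp add: matrix_vector_mul_assoc[symmetric])
qed (simp_all add: matrix_vector_right_distrib matrix_vector_mult_scaleR)

lemma mem_complex_kernel_iff:
  fixes A :: "real^'n^'n"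
  shows "x \<in> complex_kernel A (\<i> * complex_of_real \<alpha>) \<longleftrightarrow>
    A *v Re_vec x = - (\<alpha> *\<^sub>R Im_vec x) \<and> A *v Im_vec x = \<alpha> *\<^sub>R Re_vec x"
proof -
  let ?\<mu> = "\<i> * complex_of_real \<alpha>"
  have comp: "((map_matrix complex_of_real A - mat ?\<mu>) *v x) $ i
     = (\<Sum>j\<in>UNIV. complex_of_real (A $ i $ j) * x $ j) - ?\<mu> * x $ i" for i
  proof -
    have "((map_matrix complex_of_real A - mat ?\<mu>) *v x) $ i
      = (\<Sum>j\<in>UNIV. complex_of_real (A $ i $ j) * x $ j - (if j = i then ?\<mu> * x $ j else 0))"
      unfolding matrix_vector_mult_def mat_def
      by (auto simp: left_diff_distrib intro!: sum.cong)
    then show ?thesis by (simp add: sum_subtractf sum.delta')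
  qed
  have Re: "Re (((map_matrix complex_of_real A - mat ?\<mu>) *v x) $ i) = (A *v Re_vec x + \<alpha> *\<^sub>R Im_vec x) $ i" for i
    unfolding comp by (simp add: Re_vec_def Im_vec_def matrix_vector_mult_def)
  have Im: "Im (((map_matrix complex_of_real A - mat ?\<mu>) *v x) $ i) = (A *v Im_vec x - \<alpha> *\<^sub>R Re_vec x) $ i" for i
    unfolding comp by (simp add: Re_vec_def Im_vec_def matrix_vector_mult_def)
  have "x \<in> complex_kernel A ?\<mu> \<longleftrightarrow> A *v Re_vec x + \<alpha> *\<^sub>R Im_vec x = 0 \<and> A *v Im_vec x - \<alpha> *\<^sub>R Re_vec x = 0"
    unfolding complex_kernel_def mem_Collect_eq vec_eq_iff[where 'a=complex] complex_eq_iff Re Im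
    by (auto simp: vec_eq_iff)
  then show ?thesis by (simp add: eq_neg_iff_add_eq_0)
qed

lemma conservative_subspace_eq:
  fixes J R Q A :: "real^'n^'n"
  assumes "dissipative_system ip ((*v) (J ** Q)) ((*v) (R ** Q))" and A: "A = (J - R) ** Q"
  shows "conservative_subspace A = dissipative_system.cons ((*v) (J ** Q)) ((*v) (R ** Q))"
proof -
  interpret dissipative_system ip "(*v) (J ** Q)" "(*v) (R ** Q)" by fact
  have AA: "A *v x = gen x" for x
    by (simp add: A gen_def matrix_vector_mul_assoc[symmetric] matrix_vector_mult_diff_rdistrib)
  show ?thesis
  proof
    show "conservative_subspace A \<subseteq> cons"
      unfolding conservative_subspace_def real_eigenspace_def
    proof (intro span_minimal subspace_cons UN_least Un_least image_subsetI)
      fix \<alpha> and x :: "complex^'n" assume "x \<in> complex_kernel A (\<i> * complex_of_real \<alpha>)"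
      then have eig: "gen (Re_vec x) = - (\<alpha> *\<^sub>R Im_vec x)" "gen (Im_vec x) = \<alpha> *\<^sub>R Re_vec x"
        by (auto simp: mem_complex_kernel_iff AA)
      note S = imaginary_eigenpair_S[OF eig]
      have K: "(J ** Q) *v Re_vec x = - (\<alpha> *\<^sub>R Im_vec x)" "(J ** Q) *v Im_vec x = \<alpha> *\<^sub>R Re_vec x"
        using eig S by (auto simp: gen_def)
      show "Re_vec x \<in> cons" by (rule cons_I[OF K S])
      show "Im_vec x \<in> cons" by (rule cons_I2[OF K S])
    qed
    show "cons \<subseteq> conservative_subspace A"
      unfolding cons_def
    proof (rule span_minimal)
      show "subspace (conservative_subspace A)" by (simp add: conservative_subspace_def)
      show "{a. \<exists>b \<alpha>. (J ** Q) *v a = - (\<alpha> *\<^sub>R b) \<and> (J ** Q) *v b = \<alpha> *\<^sub>R a \<and> (R ** Q) *v a = 0 \<and> (R ** Q) *v b = 0}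
        \<subseteq> conservative_subspace A"
      proof clarify
        fix a b \<alpha>
        assume *: "(J ** Q) *v a = - (\<alpha> *\<^sub>R b)" "(J ** Q) *v b = \<alpha> *\<^sub>R a"
          "(R ** Q) *v a = 0" "(R ** Q) *v b = 0"
        define x where "x = (\<chi> i. Complex (a $ i) (b $ i))"
        have x: "Re_vec x = a" "Im_vec x = b" by (auto simp: x_def Re_vec_def Im_vec_def vec_eq_iff)
        have ker: "x \<in> complex_kernel A (\<i> * complex_of_real \<alpha>)"
          using * by (simp add: mem_complex_kernel_iff x AA gen_def)
        show "a \<in> conservative_subspace A"
        proof (cases "x = 0")
          case True
          then have "a = 0" using x(1) by (simp add: Re_vec_def vec_eq_iff)
          then show ?thesis by (simp add: conservative_subspace_def span_zero)
        next
          case False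
          then have "\<i> * complex_of_real \<alpha> \<in> complex_spectrum A"
            using ker unfolding complex_spectrum_def by blast
          moreover have "a \<in> real_eigenspace A (\<i> * complex_of_real \<alpha>)"
            unfolding real_eigenspace_def using ker x(1) by (intro span_base) auto
          ultimately show ?thesis unfolding conservative_subspace_def by (intro span_base) auto
        qed
      qed
    qed
  qed
qed

text \<open>Full row rank writes z as the image of some w, and then z is orthogonal to itself.
  Vanishing for all k includes the blocks of the matrix, so Cayley-Hamilton does not enter.\<close>

lemma kalman_rank_left_kernel:
  fixes A :: "real^'n^'n" and B :: "real^'m^'n"
  assumes kalman: "rank (controllability_matrix A B) = CARD('n)"
    and z: "\<And>k. transpose (((**) A ^^ k) B) *v z = 0"
  shows "z = 0"
proof -
  let ?M = "controllability_matrix A B"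
  have "(transpose ?M *v z) $ kj = (transpose (((**) A ^^ to_nat_on (UNIV :: 'n set) (fst kj)) B) *v z) $ snd kj" for kj
    by (simp add: controllability_matrix_def matrix_vector_mult_def transpose_def del: transpose_matrix_vector)
  then have "transpose ?M *v z = 0" by (simp only: z vec_eq_iff zero_index) simp
  moreover have "surj ((*v) ?M)" using kalman by (simp add: full_rank_surjective)
  then obtain w where "z = ?M *v w" by (metis surjD)
  ultimately have "z \<bullet> z = 0" using matrix_vector_inner[of ?M w z] by simp
  then show ?thesis by simp
qed

theorem lemma4:
  fixes J R Q A :: "real^'n^'n" and B :: "real^'m^'n" and ul uu :: "real^'m"
    and U :: "(real^'m) set" and M1 M2 :: "(real^'n) set"
    and J1 J2 R2 :: "real^'n \<Rightarrow> real^'n" and B1 B2 :: "real^'m \<Rightarrow> real^'n"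
    and x10 x20 :: "real^'n"
  assumes J_skew: "transpose J = - J"
    and R_sym: "transpose R = R" and R_psd: "\<And>x. 0 \<le> x \<bullet> (R *v x)"
    and Q_sym: "transpose Q = Q" and Q_pd: "\<And>x. x \<noteq> 0 \<Longrightarrow> 0 < x \<bullet> (Q *v x)"
    and m_le_n: "CARD('m) \<le> CARD('n)" and B_rank: "rank B = CARD('m)"
    and A_def: "A = (J - R) ** Q"
    and U_def: "U = cbox ul uu" and zero_int: "0 \<in> interior U"
    and kalman: "rank (controllability_matrix A B) = CARD('n)"
    and M1_def: "M1 = conservative_subspace A"
    and M2_def: "M2 = dissipative_subspace Q A"
    and J1_def: "J1 = restrict ((*v) (J ** Q)) M1"
    and J2_def: "J2 = restrict ((*v) (J ** Q)) M2"
    and R2_def: "R2 = restrict ((*v) (R ** Q)) M2"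
    and B1_def: "B1 = (\<lambda>v. proj_along M1 M2 (B *v v))"
    and B2_def: "B2 = (\<lambda>v. proj_along M2 M1 (B *v v))"
    and x10: "x10 \<in> M1" and x20: "x20 \<in> M2"
  shows "(\<forall>x1s\<in>M1. \<exists>T>0. \<exists>u\<in>L1_controls T U. steers M1 J1 B1 u T x10 x1s) \<and>
         bounded (reachable_set M2 (\<lambda>x. J2 x - R2 x) B2 U x20)"
proof -
  let ?ip = "\<lambda>x y :: real^'n. (Q *v x) \<bullet> y"
  interpret dissipative_system ?ip "(*v) (J ** Q)" "(*v) (R ** Q)"
    by (rule port_hamiltonian_dissipative_system) fact+
  have M1: "M1 = cons"
    unfolding M1_def by (rule conservative_subspace_eq[OF dissipative_system_axioms A_def])
  have M2: "M2 = diss"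
    using M1 unfolding M2_def dissipative_subspace_def diss_def M1_def by simp
  define B' where "B' = (\<lambda>y. transpose B *v (Q *v y))"
  \<comment> \<open>The transpose of A times Q is Q (- J - R) Q, and the R part vanishes on
    \<open>cons\<close>; there the transposed dynamics are those of \<open>- K\<close>, whence the
    signs in \<open>markov\<close>.\<close>
  have adjA: "transpose A *v (Q *v x) = - (Q *v ((J ** Q) *v x))" if "x \<in> cons" for x
  proof -
    have "transpose A *v (Q *v x) = Q *v ((- J - R) *v (Q *v x))"
      by (simp add: A_def matrix_transpose_mul transpose_diff J_skew R_sym Q_sym matrix_vector_mul_assoc matrix_mul_assoc
          del: transpose_matrix_vector)
    also have "(- J - R) *v (Q *v x) = - ((J ** Q) *v x)"
      using S_cons[OF that]
      by (simp add: matrix_vector_mult_diff_rdistrib matrix_vector_mult_minus_left matrix_vector_mul_assoc[symmetric])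
    finally show ?thesis by (simp add: matrix_vector_mult_minus_right)
  qed
  have markov: "\<forall>x\<in>cons. transpose (((**) A ^^ k) B) *v (Q *v x) = (-1) ^ k *\<^sub>R B' (((*v) (J ** Q) ^^ k) x)" for k
  proof (induction k)
    case 0 show ?case by (simp add: B'_def)
  next
    case (Suc k)
    show ?case
    proof
      fix x assume x: "x \<in> cons"
      have "transpose (((**) A ^^ Suc k) B) *v (Q *v x)
          = transpose (((**) A ^^ k) B) *v (transpose A *v (Q *v x))"
        by (simp add: matrix_transpose_mul matrix_vector_mul_assoc matrix_mul_assoc del: transpose_matrix_vector)
      also have "\<dots> = - (transpose (((**) A ^^ k) B) *v (Q *v ((J ** Q) *v x)))"
        by (simp add: adjA[OF x] matrix_vector_mult_minus_right del: transpose_matrix_vector)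
      also have "\<dots> = (-1) ^ Suc k *\<^sub>R B' (((*v) (J ** Q) ^^ Suc k) x)"
        using Suc K_cons[OF x] by (simp add: funpow_swap1 del: transpose_matrix_vector)
      finally show "transpose (((**) A ^^ Suc k) B) *v (Q *v x)
          = (-1) ^ Suc k *\<^sub>R B' (((*v) (J ** Q) ^^ Suc k) x)" .
    qed
  qed
  interpret observed_system ?ip "(*v) (J ** Q)" "(*v) (R ** Q)" "(*v) B" B'
  proof (intro observed_system.intro observed_system_axioms.intro dissipative_system_axioms)
    show "linear ((*v) B)" by (rule matrix_vector_mul_linear)
    show "linear B'"
      unfolding B'_def matrix_vector_mul_assoc by (rule matrix_vector_mul_linear)
    show "?ip (B *v v) y = v \<bullet> B' y" for v y
      using matrix_vector_inner[of Q "B *v v" y] matrix_vector_inner[of B v "Q *v y"] Q_sym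
      by (simp add: B'_def)
    show "x = 0" if "x \<in> cons" "\<And>k. B' (((*v) (J ** Q) ^^ k) x) = 0" for x
    proof -
      \<comment> \<open>The left kernel vector is \<open>Q *v x\<close>, because \<open>B'\<close>
        contains the weight Q.\<close>
      have "Q *v x = 0"
        by (rule kalman_rank_left_kernel[OF kalman]) (use markov that in \<open>simp del: transpose_matrix_vector\<close>)
      then show ?thesis using ip_self_eq_0[of x] by simp
    qed
  qed
  show ?thesis
  proof
    show "\<forall>x1s\<in>M1. \<exists>T>0. \<exists>u\<in>L1_controls T U. steers M1 J1 B1 u T x10 x1s"
      unfolding M1 B1_def M2
      using x10 zero_int by (intro ballI steer_cons) (auto simp: J1_def M1)
    have "bounded (B2 ` U)"
    proof -
      have "linear (\<lambda>v. B *v v - P (B *v v))"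
        using linear_compose[OF linear_B linear_proj_cons]
        by (intro linear_compose_sub linear_B) (simp add: o_def)
      then have "bounded ((\<lambda>v. B *v v - P (B *v v)) ` U)"
        by (intro bounded_linear_image) (auto simp: U_def linear_conv_bounded_linear)
      then show ?thesis by (simp add: B2_def M1 M2 proj_diss_eq)
    qed
    then show "bounded (reachable_set M2 (\<lambda>x. J2 x - R2 x) B2 U x20)"
      unfolding M2
      by (rule reachable_set_diss_bounded[rotated]) (auto simp: J2_def R2_def M2 gen_def)
  qed
qed

end
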